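(* Let $\alpha,\beta\ge2$ be integers, let $A=\begin{bmatrix}\alpha&0\\0&1\end{bmatrix}$, $B=\begin{bmatrix}1&0\\0&\beta\end{bmatrix}$, and let $(\phi,\mathfrak{V})$ be a biscaled multiresolution analysis in $L^2(\mathbb{R}^2)$ with respect to the dilation pair $(A,B)$ whose scaling function $\phi\in L^2(\mathbb{R}^2)$ has compact support. Then $\phi$ is separable, i.e. there are functions $\phi_1,\phi_2\in L^2(\mathbb{R})$ with $\phi(x,y)=\phi_1(x)\phi_2(y)$ for almost every $(x,y)\in\mathbb{R}^2$.
   Context: For $M\in\mathrm{GL}_2(\mathbb{R})$, $D_M$ is the unitary operator on $L^2(\mathbb{R}^2)$ given by $(D_Mf)(x)=|\det M|^{1/2}f(Mx)$. A biscaled multiresolution analysis (BMRA) with respect to $(A,B)$ is a pair $(\phi,\mathfrak{V})$ where $\phi\in L^2(\mathbb{R}^2)$ (the scaling function) and $\mathfrak{V}=\{V_{i,j}:(i,j)\in\mathbb{Z}^2\}$ is a family of closed subspaces of $L^2(\mathbb{R}^2)$ such that: (i) $V_{i,j}\subseteq V_{l,m}$ for $i\le l$, $j\le m$; (ii) $D_A^iD_B^jV_{0,0}=V_{i,j}$ for all $i,j$; (iii) $\bigcap_{(i,j)\in\mathbb{Z}^2}V_{i,j}=\{0\}$; (iv) $\overline{\bigcup_{(i,j)\in\mathbb{Z}^2}V_{i,j}}=L^2(\mathbb{R}^2)$; (v) the orthogonal projections $P_{i,j}$ onto $V_{i,j}$ commute pairwise; (vi) $\{\phi(x-k):k\in\mathbb{Z}^2\}$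 is an orthonormal basis of $V_{0,0}$. *)

theory Defs
  imports "HOL-Analysis.Analysis"
begin

text \<open>
  Elements of \<open>L\<^sup>2\<close> are represented by actual complex-valued functions. The squared norm below is
  only a seminorm on functions, so an element of \<open>L\<^sup>2\<close> is a class of functions up to equality
  almost everywhere, and a set of elements is a set of functions closed under this equality.
  Every set equal to its own \<open>L2_closure\<close> has this property.
\<close>

definition L2_space :: "('a::euclidean_space \<Rightarrow> complex) set" where
  "L2_space = {f \<in> borel_measurable lebesgue. integrable lebesgue (\<lambda>x. (norm (f x))\<^sup>2)}"

definition L2_norm :: "('a::euclidean_space \<Rightarrow> complex) \<Rightarrow> real" where
  "L2_norm f = sqrt (LINT x|lebesgue. (norm (f x))\<^sup>2)"

definition L2_inner :: "('a::euclidean_space \<Rightarrow> complex) \<Rightarrow> ('a \<Rightarrow> complex) \<Rightarrow> complex" where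
  "L2_inner f g = (LINT x|lebesgue. f x * cnj (g x))"

definition L2_zero :: "('a::euclidean_space \<Rightarrow> complex) set" where
  "L2_zero = {f \<in> L2_space. AE x in lebesgue. f x = 0}"

definition L2_closure ::
    "('a::euclidean_space \<Rightarrow> complex) set \<Rightarrow> ('a \<Rightarrow> complex) set" where
  "L2_closure S = {f \<in> L2_space. \<forall>e>0. \<exists>g\<in>S. L2_norm (\<lambda>x. f x - g x) < e}"

definition L2_closed_subspace :: "('a::euclidean_space \<Rightarrow> complex) set \<Rightarrow> bool" where
  "L2_closed_subspace S \<longleftrightarrow>
     S \<subseteq> L2_space \<and>
     (\<lambda>x. 0) \<in> S \<and>
     (\<forall>f\<in>S. \<forall>g\<in>S. (\<lambda>x. f x + g x) \<in> S) \<and>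
     (\<forall>c. \<forall>f\<in>S. (\<lambda>x. c * f x) \<in> S) \<and>
     L2_closure S = S"

text \<open>
  A representative of the orthogonal projection of \<open>f\<close> onto \<open>S\<close>. For a closed subspace \<open>S\<close> and
  \<open>f\<close> in \<open>L2_space\<close> it exists and is unique up to equality almost everywhere.
\<close>

definition L2_proj ::
    "('a::euclidean_space \<Rightarrow> complex) set \<Rightarrow> ('a \<Rightarrow> complex) \<Rightarrow> ('a \<Rightarrow> complex)" where
  "L2_proj S f = (SOME g. g \<in> S \<and> (\<forall>h\<in>S. L2_inner (\<lambda>x. f x - g x) h = 0))"

definition L2_projs_commute ::
    "('a::euclidean_space \<Rightarrow> complex) set \<Rightarrow> ('a \<Rightarrow> complex) set \<Rightarrow> bool" where
  "L2_projs_commute S T \<longleftrightarrow>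
     (\<forall>f\<in>L2_space. AE x in lebesgue. L2_proj S (L2_proj T f) x = L2_proj T (L2_proj S f) x)"

definition L2_orthonormal_basis ::
    "'i set \<Rightarrow> ('i \<Rightarrow> 'a::euclidean_space \<Rightarrow> complex) \<Rightarrow> ('a \<Rightarrow> complex) set \<Rightarrow> bool" where
  "L2_orthonormal_basis I e S \<longleftrightarrow>
     (\<forall>i\<in>I. e i \<in> S) \<and>
     (\<forall>i\<in>I. \<forall>j\<in>I. L2_inner (e i) (e j) = (if i = j then 1 else 0)) \<and>
     L2_closure {\<lambda>x. \<Sum>i\<in>F. c i * e i x | F c. finite F \<and> F \<subseteq> I} = S"

definition dilation :: "real^2^2 \<Rightarrow> (real^2 \<Rightarrow> complex) \<Rightarrow> (real^2 \<Rightarrow> complex)" where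
  "dilation M f = (\<lambda>x. complex_of_real (sqrt \<bar>det M\<bar>) * f (M *v x))"

text \<open>
  Integer powers of a bijective operator. For an invertible matrix \<open>M\<close>, the map \<open>dilation M\<close> is a
  bijection on the set of all functions, so \<open>inv\<close> is its genuine inverse.
\<close>

definition int_funpow :: "('b \<Rightarrow> 'b) \<Rightarrow> int \<Rightarrow> ('b \<Rightarrow> 'b)" where
  "int_funpow T i = (if 0 \<le> i then T ^^ nat i else inv T ^^ nat (- i))"

definition BMRA ::
    "real^2^2 \<Rightarrow> real^2^2 \<Rightarrow> (real^2 \<Rightarrow> complex) \<Rightarrow> (int \<Rightarrow> int \<Rightarrow> (real^2 \<Rightarrow> complex) set) \<Rightarrow> bool"
  where
  "BMRA A B \<phi> V \<longleftrightarrow>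
     invertible A \<and> invertible B \<and>
     \<phi> \<in> L2_space \<and>
     (\<forall>i j. L2_closed_subspace (V i j)) \<and>
     (\<forall>i j l m. i \<le> l \<and> j \<le> m \<longrightarrow> V i j \<subseteq> V l m) \<and>
     (\<forall>i j. (int_funpow (dilation A) i \<circ> int_funpow (dilation B) j) ` V 0 0 = V i j) \<and>
     (\<Inter>i. \<Inter>j. V i j) = L2_zero \<and>
     L2_closure (\<Union>i. \<Union>j. V i j) = L2_space \<and>
     (\<forall>i j l m. L2_projs_commute (V i j) (V l m)) \<and>
     L2_orthonormal_basis {k. \<forall>n. k $ n \<in> \<int>} (\<lambda>k x. \<phi> (x - k)) (V 0 0)"

text \<open>
  Compactness of the essential support, which depends only on the class of \<open>f\<close> up to equality
  almost everywhere.
\<close>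

definition compactly_supported :: "('a::euclidean_space \<Rightarrow> complex) \<Rightarrow> bool" where
  "compactly_supported f \<longleftrightarrow> (\<exists>K. compact K \<and> (AE x in lebesgue. x \<notin> K \<longrightarrow> f x = 0))"

definition separable :: "(real^2 \<Rightarrow> complex) \<Rightarrow> bool" where
  "separable f \<longleftrightarrow>
     (\<exists>f1 f2 :: real \<Rightarrow> complex. f1 \<in> L2_space \<and> f2 \<in> L2_space \<and>
        (AE p in lebesgue. f p = f1 (p $ 1) * f2 (p $ 2)))"

end

theory Submission
  imports Defs
begin

text \<open>
  Let \<open>u\<close>, \<open>v\<close> be the marginals of \<open>\<phi>\<close>, obtained by integrating out \<open>y\<close> and \<open>x\<close> respectively. Since
  \<open>V 0 0 \<subseteq> V n 0\<close>, \<open>\<phi>\<close> is a finite sum of multiples of \<open>\<phi>(N x - k, y - l)\<close> with \<open>N = \<alpha>\<^sup>n\<close>, where \<open>\<bar>l\<bar>\<close>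
  is bounded independently of \<open>n\<close>. For large \<open>N\<close> these atoms concentrate at \<open>x = k / N\<close> and look like
  multiples of \<open>v(y - l)\<close>; hence the slices \<open>\<phi>(x, -)\<close> lie in the span of finitely many shifts of \<open>v\<close>.
  Symmetrically the slices \<open>\<phi>(-, y)\<close> lie in the span of finitely many shifts of \<open>u\<close>, so that
  \<open>\<phi>(x, y) = \<Sum> h k l * u(x - k) * v(y - l)\<close> with a finite sum. Orthonormality of the integer shifts of
  \<open>\<phi>\<close> makes the Laurent polynomial with coefficients \<open>h\<close> a unit, hence a monomial.
\<close>

subsection \<open>Step functions and their functionals\<close>

text \<open>Slices of \<open>\<Phi>\<close> make sense only almost everywhere and the concentration
  of the atoms is a weak limit, so the span statement is proved in dual form: a test function
  \<open>q\<close> that annihilates the relevant shifts of the marginal must give pairing zero with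
  every \<open>indicator {..s}\<close> in the other variable. The sharp cut makes the error
  countable: an atom of half-width \<open>R\<close> lies wholly on one side of the cut unless its
  centre is within \<open>R\<close> of it, so the number of bad atoms does not grow with
  \<open>N\<close>; under a smooth weight every atom would contribute an error. The bad atoms lose
  against the scaling: the normalised dilate has norm one, so its coefficients are at most 1 and the
  atoms enter with the factor \<open>sqrt N\<close>, whereas stretching multiplies the pairing by
  \<open>N\<close>. Half-lines also suffice to recover \<open>\<Phi>\<close>, since their products,
  the quadrants, form a pi-system. In the last step the shifts of the two marginals are not known to
  be orthonormal, so their autocorrelations enter the coefficient identity as further Laurent
  polynomials.\<close>

inductive_set step_functions :: "(real \<Rightarrow> complex) set" where
  half_line: "(\<lambda>x. indicator {..s} x) \<in> step_functions"
| add: "p \<in> step_functions \<Longrightarrow> q \<in> step_functions \<Longrightarrow> (\<lambda>x. p x + q x) \<in> step_functions"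
| scale: "p \<in> step_functions \<Longrightarrow> (\<lambda>x. c * p x) \<in> step_functions"

lemma step_functions_zero: "(\<lambda>x. 0) \<in> step_functions"
  using step_functions.scale[OF step_functions.half_line, of 0] by simp

lemma step_functions_sum:
  assumes "finite L" "\<And>l. l \<in> L \<Longrightarrow> e l \<in> step_functions"
  shows "(\<lambda>x. \<Sum>l\<in>L. c l * e l x) \<in> step_functions"
  using assms by (induction L) (auto intro!: step_functions.intros(2,3) step_functions_zero)

lemma step_functions_measurable: "p \<in> step_functions \<Longrightarrow> p \<in> borel_measurable borel"
  by (induction rule: step_functions.induct) (auto intro!: borel_measurable_add borel_measurable_times)

lemma step_functions_bounded: "p \<in> step_functions \<Longrightarrow> \<exists>C. \<forall>x. norm (p x) \<le> C"
proof (induction rule: step_functions.induct)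
  case (half_line s)
  show ?case by (rule exI[of _ 1]) (auto simp: indicator_def)
next
  case (add p q)
  then obtain C D where "\<forall>x. norm (p x) \<le> C" "\<forall>x. norm (q x) \<le> D" by blast
  then show ?case
    by (intro exI[of _ "C + D"]) (meson add_mono norm_triangle_le)
next
  case (scale p c)
  then obtain C where "\<forall>x. norm (p x) \<le> C" by blast
  then show ?case
    by (intro exI[of _ "norm c * C"]) (auto simp: norm_mult intro: mult_left_mono)
qed

text \<open>Linearity is asked only on \<open>step_functions\<close> because the functionals are
  integrals, additive only where the integrands are integrable.\<close>

definition step_linear :: "((real \<Rightarrow> complex) \<Rightarrow> complex) \<Rightarrow> bool" where
  "step_linear f \<longleftrightarrow>
     (\<forall>p\<in>step_functions. \<forall>q\<in>step_functions. f (\<lambda>x. p x + q x) = f p + f q) \<and>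
     (\<forall>c. \<forall>p\<in>step_functions. f (\<lambda>x. c * p x) = c * f p)"

lemma step_linear_add:
  "step_linear f \<Longrightarrow> p \<in> step_functions \<Longrightarrow> q \<in> step_functions \<Longrightarrow>
    f (\<lambda>x. p x + q x) = f p + f q"
  by (simp add: step_linear_def)

lemma step_linear_scale:
  "step_linear f \<Longrightarrow> p \<in> step_functions \<Longrightarrow> f (\<lambda>x. c * p x) = c * f p"
  by (simp add: step_linear_def)

lemma step_linear_sum:
  assumes "step_linear f" "finite L" "\<And>l. l \<in> L \<Longrightarrow> e l \<in> step_functions"
  shows "f (\<lambda>x. \<Sum>l\<in>L. c l * e l x) = (\<Sum>l\<in>L. c l * f (e l))"
  using assms(2,3)
proof (induction L)
  case empty
  show ?case
    using step_linear_scale[OF assms(1) step_functions_zero, of 0] by simp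
next
  case (insert l L)
  then have "f (\<lambda>x. c l * e l x + (\<Sum>l\<in>L. c l * e l x))
      = f (\<lambda>x. c l * e l x) + f (\<lambda>x. \<Sum>l\<in>L. c l * e l x)"
    by (intro step_linear_add[OF assms(1)] step_functions.scale step_functions_sum) auto
  then show ?case
    using insert step_linear_scale[OF assms(1)] by simp
qed

lemma step_linear_eqI:
  assumes f: "step_linear f" and g: "step_linear g"
    and eq: "\<And>s. f (\<lambda>x. indicator {..s} x) = g (\<lambda>x. indicator {..s} x)"
    and p: "p \<in> step_functions"
  shows "f p = g p"
  using p f g unfolding step_linear_def
  by (induction rule: step_functions.induct) (simp_all add: eq)

text \<open>Without linear independence of the \<open>v l\<close> there is no dual basis. The
  identity asks only that \<open>q\<close> and the sum of the \<open>v l q * e l\<close> agree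
  modulo the common kernel, a form that survives induction on \<open>L\<close> even when functionals
  are dependent.\<close>

lemma dual_step_functions:
  assumes "finite L" and "\<And>l. l \<in> L \<Longrightarrow> step_linear (v l)"
  shows "\<exists>e. (\<forall>l\<in>L. e l \<in> step_functions) \<and>
    (\<forall>q\<in>step_functions. \<forall>m\<in>L. v m q = (\<Sum>l\<in>L. v l q * v m (e l)))"
  using assms
proof (induction L)
  case empty
  show ?case by simp
next
  case (insert m L)
  have lin: "\<And>l. l \<in> insert m L \<Longrightarrow> step_linear (v l)" by (rule insert.prems)
  have "\<exists>e. (\<forall>l\<in>L. e l \<in> step_functions) \<and>
      (\<forall>q\<in>step_functions. \<forall>m\<in>L. v m q = (\<Sum>l\<in>L. v l q * v m (e l)))"
    by (rule insert.IH) (rule lin[OF insertI2])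
  then obtain e where e: "\<And>l. l \<in> L \<Longrightarrow> e l \<in> step_functions"
    and exp: "\<And>q l. q \<in> step_functions \<Longrightarrow> l \<in> L \<Longrightarrow> v l q = (\<Sum>k\<in>L. v k q * v l (e k))"
    by auto
  show ?case
  proof (cases "\<forall>q\<in>step_functions. (\<forall>l\<in>L. v l q = 0) \<longrightarrow> v m q = 0")
    case True
    \<comment> \<open>Here \<open>v m\<close> vanishes on the common kernel of the earlier
      functionals, so it is a combination of them and needs no test function of its own; the zero
      function fills its place.\<close>
    define e' where "e' = e(m := (\<lambda>x. 0))"
    have e': "\<And>l. l \<in> L \<Longrightarrow> e' l = e l" using insert.hyps by (auto simp: e'_def)
    have z: "v l (e' m) = 0" if "l \<in> insert m L" for l
      using step_linear_scale[OF lin[OF that] step_functions_zero, of 0]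
      by (simp add: e'_def)
    have "v k q = (\<Sum>l\<in>insert m L. v l q * v k (e' l))"
      if q: "q \<in> step_functions" and k: "k \<in> insert m L" for q k
    proof -
      define r where "r = (\<lambda>x. q x + (-1) * (\<Sum>l\<in>L. v l q * e l x))"
      have s: "(\<lambda>x. \<Sum>l\<in>L. v l q * e l x) \<in> step_functions"
        using insert.hyps e by (intro step_functions_sum) auto
      have r: "r \<in> step_functions"
        unfolding r_def by (intro step_functions.intros q s)
      have vr: "v l r = v l q - (\<Sum>k\<in>L. v k q * v l (e k))" if l: "l \<in> insert m L" for l
      proof -
        have "v l r = v l q + v l (\<lambda>x. (-1) * (\<Sum>l\<in>L. v l q * e l x))"
          unfolding r_def
          by (rule step_linear_add[OF lin[OF l] q step_functions.scale[OF s]])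
        also have "v l (\<lambda>x. (-1) * (\<Sum>l\<in>L. v l q * e l x)) = (-1) * v l (\<lambda>x. \<Sum>l\<in>L. v l q * e l x)"
          by (rule step_linear_scale[OF lin[OF l] s])
        also have "v l (\<lambda>x. \<Sum>l\<in>L. v l q * e l x) = (\<Sum>k\<in>L. v k q * v l (e k))"
          by (rule step_linear_sum) (use lin l insert.hyps e in auto)
        finally show ?thesis by simp
      qed
      have "\<forall>l\<in>L. v l r = 0" using vr exp[OF q] by auto
      with True r have "v m r = 0" by blast
      then have "v k r = 0" using k \<open>\<forall>l\<in>L. v l r = 0\<close> by blast
      then show ?thesis
        using vr[OF k] insert.hyps e' z[OF k] by simp
    qed
    then show ?thesis
      by (intro exI[of _ e']) (auto simp: e'_def e step_functions_zero)
  next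
    case False
    then obtain q1 where q1: "q1 \<in> step_functions" "\<And>l. l \<in> L \<Longrightarrow> v l q1 = 0" "v m q1 \<noteq> 0"
      by blast
    define q0 where "q0 = (\<lambda>x. inverse (v m q1) * q1 x)"
    have q0: "q0 \<in> step_functions" unfolding q0_def by (intro step_functions.scale q1)
    have v0: "v l q0 = inverse (v m q1) * v l q1" if "l \<in> insert m L" for l
      unfolding q0_def by (rule step_linear_scale[OF lin[OF that] q1(1)])
    have v0L: "v l q0 = 0" if "l \<in> L" for l using v0 q1 that by simp
    have v0m: "v m q0 = 1" using v0 q1 by simp
    \<comment> \<open>\<open>q0\<close> is invisible to the earlier functionals and normalised for
      \<open>v m\<close>; subtracting \<open>v m (e l)\<close> times \<open>q0\<close> makes each
      old \<open>e l\<close> invisible to \<open>v m\<close> without disturbing the earlier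
      values.\<close>
    define e' where "e' = (\<lambda>l. if l = m then q0 else (\<lambda>x. e l x + (- v m (e l)) * q0 x))"
    have e'L: "e' l = (\<lambda>x. e l x + (- v m (e l)) * q0 x)" if "l \<in> L" for l
      using that insert.hyps by (auto simp: e'_def)
    have e'm: "e' m = q0" by (simp add: e'_def)
    have e's: "e' l \<in> step_functions" if "l \<in> insert m L" for l
    proof (cases "l = m")
      case False
      then have "l \<in> L" using that by simp
      then show ?thesis
        unfolding e'L[OF \<open>l \<in> L\<close>] by (intro step_functions.add step_functions.scale e q0)
    qed (simp add: e'm q0)
    have vk: "v k (e' l) = v k (e l) - v m (e l) * v k q0"
      if k: "k \<in> insert m L" and l: "l \<in> L" for k l
    proof -
      have "v k (e' l) = v k (e l) + v k (\<lambda>x. (- v m (e l)) * q0 x)"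
        unfolding e'L[OF l]
        by (rule step_linear_add[OF lin[OF k] e[OF l] step_functions.scale[OF q0]])
      also have "v k (\<lambda>x. (- v m (e l)) * q0 x) = (- v m (e l)) * v k q0"
        by (rule step_linear_scale[OF lin[OF k] q0])
      finally show ?thesis by simp
    qed
    have "v k q = (\<Sum>l\<in>insert m L. v l q * v k (e' l))"
      if q: "q \<in> step_functions" and k: "k \<in> insert m L" for q k
    proof -
      have "(\<Sum>l\<in>L. v l q * v k (e' l))
          = (\<Sum>l\<in>L. v l q * v k (e l)) - (\<Sum>l\<in>L. v l q * v m (e l)) * v k q0"
        unfolding sum_distrib_right sum_subtractf[symmetric]
        by (intro sum.cong refl) (simp add: vk[OF k] algebra_simps)
      then show ?thesis
        using k insert.hyps exp[OF q] v0L v0m by (auto simp: e'm)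
    qed
    then show ?thesis using e's by blast
  qed
qed

text \<open>A functional vanishing on a finite intersection of kernels is a combination of the
  \<open>v l\<close>. The order of quantifiers matters: the \<open>e l\<close> are fixed before
  \<open>g\<close>, so the coefficients \<open>g (e l)\<close> are linear in \<open>g\<close> and
  the same test functions serve a whole family of functionals.\<close>

lemma step_linear_in_span:
  assumes L: "finite L" and v: "\<And>l. l \<in> L \<Longrightarrow> step_linear (v l)"
  shows "\<exists>e. (\<forall>l\<in>L. e l \<in> step_functions) \<and>
    (\<forall>g. step_linear g \<longrightarrow> (\<forall>q\<in>step_functions. (\<forall>l\<in>L. v l q = 0) \<longrightarrow> g q = 0) \<longrightarrow>
      (\<forall>q\<in>step_functions. g q = (\<Sum>l\<in>L. v l q * g (e l))))"
proof -
  obtain e where e: "\<And>l. l \<in> L \<Longrightarrow> e l \<in> step_functions"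
    and exp: "\<And>q m. q \<in> step_functions \<Longrightarrow> m \<in> L \<Longrightarrow> v m q = (\<Sum>l\<in>L. v l q * v m (e l))"
    using dual_step_functions[where v=v, OF L v] by auto
  have "g q = (\<Sum>l\<in>L. v l q * g (e l))"
    if g: "step_linear g" and ker: "\<And>q. q \<in> step_functions \<Longrightarrow> (\<forall>l\<in>L. v l q = 0) \<Longrightarrow> g q = 0"
      and q: "q \<in> step_functions" for g q
  proof -
    have s: "(\<lambda>x. \<Sum>l\<in>L. v l q * e l x) \<in> step_functions"
      using L e by (intro step_functions_sum) auto
    define r where "r = (\<lambda>x. q x + (-1) * (\<Sum>l\<in>L. v l q * e l x))"
    have r: "r \<in> step_functions"
      unfolding r_def by (intro step_functions.intros q s)
    have fr: "f r = f q - (\<Sum>l\<in>L. v l q * f (e l))" if f: "step_linear f" for f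
    proof -
      have "f r = f q + f (\<lambda>x. (-1) * (\<Sum>l\<in>L. v l q * e l x))"
        unfolding r_def by (rule step_linear_add[OF f q step_functions.scale[OF s]])
      also have "f (\<lambda>x. (-1) * (\<Sum>l\<in>L. v l q * e l x)) = (-1) * f (\<lambda>x. \<Sum>l\<in>L. v l q * e l x)"
        by (rule step_linear_scale[OF f s])
      also have "f (\<lambda>x. \<Sum>l\<in>L. v l q * e l x) = (\<Sum>k\<in>L. v k q * f (e k))"
        by (rule step_linear_sum[OF f L e])
      finally show ?thesis by simp
    qed
    have "\<forall>l\<in>L. v l r = 0"
    proof
      fix l assume l: "l \<in> L"
      show "v l r = 0" using fr[OF v[OF l]] exp[OF q l] by (metis diff_self)
    qed
    then have "g r = 0" by (rule ker[OF r])
    then show ?thesis using fr[OF g] by simp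
  qed
  then show ?thesis using e by (intro exI[of _ e]) blast
qed

subsection \<open>Integration in the plane\<close>

text \<open>Quadrants generate the Borel sets and are closed under intersection, so a pi-lambda
  induction gives vanishing integrals over all Borel sets.\<close>

lemma AE_zero_if_quadrants:
  fixes f :: "real \<times> real \<Rightarrow> complex"
  assumes f: "integrable lborel f"
    and zero: "\<And>s t. (LINT z|lborel. f z * indicator {..s} (fst z) * indicator {..t} (snd z)) = 0"
  shows "AE z in lborel. f z = 0"
proof -
  have [measurable]: "f \<in> borel_measurable borel" using f by auto
  have int: "integrable lborel (\<lambda>z. indicator A z *\<^sub>R f z)" if "A \<in> sets borel" for A
    using f that by (intro integrable_mult_indicator) auto
  have quad: "(LINT z|lborel. indicator {..a} z *\<^sub>R f z) = 0" for a :: "real \<times> real"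
  proof -
    have "indicator {..a} z *\<^sub>R f z = f z * indicator {..fst a} (fst z) * indicator {..snd a} (snd z)" for z
      by (auto simp: indicator_def less_eq_prod_def)
    then show ?thesis using zero[of "fst a" "snd a"] by simp
  qed
  \<comment> \<open>The plane itself is not a quadrant, yet the complement step needs its integral;
    the quadrants with corner \<open>(real n, real n)\<close> exhaust it.\<close>
  have top: "integral\<^sup>L lborel f = 0"
  proof -
    have "(\<lambda>n. LINT z|lborel. indicator {..(real n, real n)} z *\<^sub>R f z) \<longlonglongrightarrow> integral\<^sup>L lborel f"
    proof (rule integral_dominated_convergence[where w="\<lambda>z. norm (f z)"])
      show "AE z in lborel. (\<lambda>n. indicator {..(real n, real n)} z *\<^sub>R f z) \<longlonglongrightarrow> f z"
      proof (rule AE_I2)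
        fix z :: "real \<times> real"
        obtain N where N: "max (fst z) (snd z) \<le> real N" using real_arch_simple by blast
        have "eventually (\<lambda>n. indicator {..(real n, real n)} z *\<^sub>R f z = f z) sequentially"
          using eventually_ge_at_top[of N] by eventually_elim (use N in \<open>auto simp: less_eq_prod_def\<close>)
        then show "(\<lambda>n. indicator {..(real n, real n)} z *\<^sub>R f z) \<longlonglongrightarrow> f z"
          by (rule tendsto_eventually)
      qed
    qed (use f in \<open>auto simp: indicator_def\<close>)
    then show ?thesis unfolding quad by (simp add: LIMSEQ_const_iff)
  qed
  have "(LINT z|lborel. indicator A z *\<^sub>R f z) = 0" if A: "A \<in> sets borel" for A
  proof -
    have S: "A \<in> sigma_sets UNIV (range (\<lambda>a. {..a::real \<times> real}))"
      using A unfolding borel_eq_atMost by simp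
    have "Int_stable (range (\<lambda>a. {..a::real \<times> real}))"
    proof (rule Int_stableI)
      fix a b assume "a \<in> range (\<lambda>a. {..a::real \<times> real})" "b \<in> range (\<lambda>a. {..a::real \<times> real})"
      then obtain p q where "a = {..p}" "b = {..q}" by auto
      then have "a \<inter> b = {..inf p q}" by auto
      then show "a \<inter> b \<in> range (\<lambda>a. {..a::real \<times> real})" by blast
    qed
    then show ?thesis
      using subset_UNIV[of "range atMost"] S unfolding Pow_UNIV[symmetric]
    proof (induction rule: sigma_sets_induct_disjoint)
      case (basic A)
      then show ?case using quad by auto
    next
      case empty
      show ?case by simp
    next
      case (compl A)
      then have [measurable]: "A \<in> sets borel" unfolding borel_eq_atMost by simp
      have "(LINT z|lborel. indicator (UNIV - A) z *\<^sub>R f z)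
          = (LINT z|lborel. f z - indicator A z *\<^sub>R f z)"
        by (intro Bochner_Integration.integral_cong) (auto simp: indicator_def)
      also have "\<dots> = 0" using f int[of A] top compl by simp
      finally show ?case .
    next
      case (union A)
      then have m: "A i \<in> sets borel" for i unfolding borel_eq_atMost by auto
      have "(LINT z:(\<Union>i. A i)|lborel. f z) = (\<Sum>i. (LINT z:A i|lborel. f z))"
        using union m int[of "\<Union>i. A i"]
        by (intro lebesgue_integral_countable_add)
           (auto simp: disjoint_family_on_def set_integrable_def)
      then show ?case using union(3) by (simp add: set_lebesgue_integral_def)
    qed
  qed
  then show ?thesis
    by (intro sigma_finite_measure.density_zero[OF sigma_finite_lborel f]) (auto simp: set_lebesgue_integral_def)
qed

lemma measurable_fst_borel [measurable]: "fst \<in> borel_measurable (borel :: (real \<times> real) measure)"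
  and measurable_snd_borel [measurable]: "snd \<in> borel_measurable (borel :: (real \<times> real) measure)"
  by (auto intro!: borel_measurable_continuous_onI continuous_intros)

lemma lborel_integral_shift:
  fixes f :: "'a::euclidean_space \<Rightarrow> complex"
  assumes [measurable]: "f \<in> borel_measurable borel"
  shows "(LINT z|lborel. f (z - a)) = integral\<^sup>L lborel f"
proof -
  have "integral\<^sup>L (distr lborel borel ((+) (- a))) f = (LINT z|lborel. f (- a + z))"
    by (intro integral_distr) auto
  then show ?thesis by (simp add: lborel_distr_plus)
qed

lemma lborel_integrable_shift:
  fixes f :: "'a::euclidean_space \<Rightarrow> 'b::{banach,second_countable_topology}"
  assumes "integrable lborel f"
  shows "integrable lborel (\<lambda>z. f (z - a))"
proof -
  have "integrable (distr lborel borel ((+) (- a))) f"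
    using assms by (simp add: lborel_distr_plus)
  then have "integrable lborel (\<lambda>z. f (- a + z))"
    by (rule integrable_distr[rotated]) auto
  then show ?thesis by simp
qed

lemma AE_lborel_shift:
  assumes "AE z in lborel. P z"
  shows "AE z in lborel. P (z - a :: 'a::euclidean_space)"
proof -
  have "AE z in distr lborel borel ((+) (- a)). P z"
    using assms unfolding lborel_distr_plus .
  then have "AE z in lborel. P (- a + z)"
    by (rule AE_distrD[rotated]) auto
  then show ?thesis by simp
qed

lemma lborel_scale_fst:
  assumes "N > 0"
  shows "lborel = density (distr lborel borel (\<lambda>z::real \<times> real. (N * fst z, snd z))) (\<lambda>_. ennreal N)"
proof -
  define c where "c = (\<lambda>j::real \<times> real. if j = (1, 0) then N else 1)"
  have "lborel = density (distr lborel borel (\<lambda>z. 0 + (\<Sum>j\<in>Basis. (c j * (z \<bullet> j)) *\<^sub>R j)))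
      (\<lambda>_. ennreal (\<Prod>j\<in>Basis. \<bar>c j\<bar>))"
    using assms by (intro lborel_affine_euclidean) (auto simp: c_def)
  moreover have "(\<lambda>z. 0 + (\<Sum>j\<in>Basis. (c j * (z \<bullet> j)) *\<^sub>R j)) = (\<lambda>z. (N * fst z, snd z))"
    by (auto simp: c_def Basis_prod_def fun_eq_iff inner_prod_def)
  moreover have "(\<Prod>j\<in>Basis. \<bar>c j\<bar>) = N"
    using assms by (simp add: c_def Basis_prod_def)
  ultimately show ?thesis by simp
qed

lemma lborel_integral_scale_fst:
  fixes f :: "real \<times> real \<Rightarrow> complex"
  assumes N: "N > 0" and [measurable]: "f \<in> borel_measurable borel"
  shows "(LINT z|lborel. f (fst z / N, snd z)) = of_real N * integral\<^sup>L lborel f"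
proof -
  have "(LINT z|lborel. f (fst z / N, snd z)) =
    (LINT z|density (distr lborel borel (\<lambda>z::real \<times> real. (N * fst z, snd z))) (\<lambda>_. ennreal N). f (fst z / N, snd z))"
    using lborel_scale_fst[OF N] by simp
  also have "\<dots> = (LINT z|lborel. N *\<^sub>R f z)"
    using N by (simp add: integral_density integral_distr)
  finally show ?thesis by (simp add: scaleR_conv_of_real)
qed

lemma
  fixes a b :: "real \<Rightarrow> complex"
  assumes a: "integrable lborel a" and b: "integrable lborel b"
  shows integrable_tensor: "integrable lborel (\<lambda>z. a (fst z) * b (snd z))"
    and integral_tensor: "(LINT z|lborel. a (fst z) * b (snd z)) = integral\<^sup>L lborel a * integral\<^sup>L lborel b"
proof -
  have [measurable]: "a \<in> borel_measurable borel" "b \<in> borel_measurable borel"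
    using a b by auto
  show int: "integrable lborel (\<lambda>z. a (fst z) * b (snd z))"
    unfolding lborel_prod[symmetric]
    by (rule lborel_pair.Fubini_integrable) (use a b in \<open>auto simp: norm_mult\<close>)
  show "(LINT z|lborel. a (fst z) * b (snd z)) = integral\<^sup>L lborel a * integral\<^sup>L lborel b"
    using lborel_pair.integral_fst'[of "\<lambda>z. a (fst z) * b (snd z)"] int
    by (simp add: lborel_prod)
qed

subsection \<open>Refinable functions with bounded support\<close>

text \<open>There is no conjugate, so the pairing is complex-linear in each test function.\<close>

definition bilinear_pairing ::
    "(real \<times> real \<Rightarrow> complex) \<Rightarrow> (real \<Rightarrow> complex) \<Rightarrow> (real \<Rightarrow> complex) \<Rightarrow> complex" where
  "bilinear_pairing \<Phi> p q = (LINT z|lborel. \<Phi> z * p (fst z) * q (snd z))"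

definition marginal :: "(real \<times> real \<Rightarrow> complex) \<Rightarrow> real \<Rightarrow> complex" where
  "marginal \<Phi> y = (LINT x|lborel. \<Phi> (x, y))"

definition shift_pairing :: "(real \<Rightarrow> complex) \<Rightarrow> int \<Rightarrow> (real \<Rightarrow> complex) \<Rightarrow> complex" where
  "shift_pairing v l q = (LINT y|lborel. v (y - of_int l) * q y)"

text \<open>The first shift is unrestricted, because the stretched support meets a number of lattice
  columns proportional to \<open>N\<close>; the second is bounded by an \<open>L\<close> fixed
  before \<open>N\<close>. The factor \<open>sqrt N\<close> undoes the normalisation of the dilate,
  which is why 1 is the natural bound for the coefficients.\<close>

definition refinable_fst :: "(real \<times> real \<Rightarrow> complex) \<Rightarrow> int \<Rightarrow> bool" where
  "refinable_fst \<Phi> L \<longleftrightarrow> (\<forall>X. \<exists>N>X. N > 0 \<and> (\<exists>F::(int \<times> int) set. \<exists>a.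
     finite F \<and> F \<subseteq> UNIV \<times> {-L..L} \<and> (\<forall>k\<in>F. norm (a k) \<le> 1) \<and>
     (AE z in lborel. \<Phi> (fst z / N, snd z) =
       of_real (sqrt N) * (\<Sum>k\<in>F. a k * \<Phi> (z - (of_int (fst k), of_int (snd k)))))))"

text \<open>A Borel representative vanishing at every point outside the square, so that support
  arguments for slices and marginals involve no exceptional null sets.\<close>

locale box_function =
  fixes \<Phi> :: "real \<times> real \<Rightarrow> complex" and R :: real
  assumes meas [measurable]: "\<Phi> \<in> borel_measurable borel"
    and R_nonneg: "0 \<le> R"
    and supp: "\<And>x y. R < \<bar>x\<bar> \<or> R < \<bar>y\<bar> \<Longrightarrow> \<Phi> (x, y) = 0"
    and sq_int: "integrable lborel (\<lambda>z. (norm (\<Phi> z))\<^sup>2)"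
begin

text \<open>On a bounded set square integrability implies integrability through
  \<open>t \<le> 1 + t\<^sup>2\<close>; the constant 1 is charged only inside the square.\<close>

lemma integrable_Phi: "integrable lborel \<Phi>"
proof (rule Bochner_Integration.integrable_bound)
  show "integrable lborel (\<lambda>z. indicator (cbox (-R, -R) (R, R)) z + (norm (\<Phi> z))\<^sup>2)"
    by (intro Bochner_Integration.integrable_add sq_int) (simp add: emeasure_lborel_cbox_eq)
  have "norm (\<Phi> z) \<le> norm (indicator (cbox (-R, -R) (R, R)) z + (norm (\<Phi> z))\<^sup>2)" for z
  proof (cases "\<Phi> z = 0")
    case False
    obtain x y where z: "z = (x, y)" by (cases z)
    have "z \<in> cbox (-R, -R) (R, R)"
      using False supp[of x y] by (force simp: z cbox_Pair_eq)
    moreover have "t \<le> 1 + t\<^sup>2" for t :: real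
      using zero_le_power2[of "t - 1/2"] by (simp add: power2_eq_square algebra_simps)
    ultimately show ?thesis by simp
  qed simp
  then show "AE z in lborel. norm (\<Phi> z) \<le> norm (indicator (cbox (-R, -R) (R, R)) z + (norm (\<Phi> z))\<^sup>2)"
    by simp
qed simp

lemma integrable_Phi_times:
  assumes w [measurable]: "w \<in> borel_measurable borel" and C: "\<And>z. norm (w z) \<le> C"
  shows "integrable lborel (\<lambda>z. \<Phi> z * w z)"
    and "norm (LINT z|lborel. \<Phi> z * w z) \<le> C * (LINT z|lborel. norm (\<Phi> z))"
proof -
  have b: "norm (\<Phi> z * w z) \<le> C * norm (\<Phi> z)" for z
    using mult_left_mono[OF C[of z], of "norm (\<Phi> z)"] by (simp add: norm_mult mult.commute)
  have i: "integrable lborel (\<lambda>z. C * norm (\<Phi> z))" using integrable_Phi by simp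
  show int: "integrable lborel (\<lambda>z. \<Phi> z * w z)"
    by (rule Bochner_Integration.integrable_bound[OF i]) (use b in \<open>auto intro!: order_trans[OF b]\<close>)
  have "norm (LINT z|lborel. \<Phi> z * w z) \<le> (LINT z|lborel. C * norm (\<Phi> z))"
    by (rule Bochner_Integration.integral_norm_bound_integral[OF int i]) (use b in auto)
  then show "norm (LINT z|lborel. \<Phi> z * w z) \<le> C * (LINT z|lborel. norm (\<Phi> z))" by simp
qed

lemma integrable_pairing:
  assumes "p \<in> step_functions" "q \<in> step_functions"
  shows "integrable lborel (\<lambda>z. \<Phi> z * p (fst z) * q (snd z))"
proof -
  note [measurable] = step_functions_measurable[OF assms(1)] step_functions_measurable[OF assms(2)]
  obtain C D where "\<And>x. norm (p x) \<le> C" "\<And>x. norm (q x) \<le> D"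
    using assms step_functions_bounded by meson
  then have "norm (p (fst z) * q (snd z)) \<le> C * D" for z
    by (auto simp: norm_mult intro!: mult_mono intro: order_trans[OF norm_ge_zero])
  then have "integrable lborel (\<lambda>z. \<Phi> z * (p (fst z) * q (snd z)))"
    by (intro integrable_Phi_times(1)) auto
  then show ?thesis by (simp add: mult.assoc)
qed

lemma integrable_marginal: "integrable lborel (marginal \<Phi>)"
  unfolding marginal_def
  using lborel_pair.integrable_snd[of "\<lambda>x y. \<Phi> (x, y)"] integrable_Phi by (simp add: lborel_prod)

lemma marginal_measurable [measurable]: "marginal \<Phi> \<in> borel_measurable borel"
  using integrable_marginal by auto

lemma marginal_supp: "R < \<bar>y\<bar> \<Longrightarrow> marginal \<Phi> y = 0"
  by (simp add: marginal_def supp)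

lemma integral_marginal:
  assumes [measurable]: "w \<in> borel_measurable borel" and C: "\<And>y. norm (w y) \<le> C"
  shows "(LINT z|lborel. \<Phi> z * w (snd z)) = (LINT y|lborel. marginal \<Phi> y * w y)"
proof -
  have "integrable lborel (\<lambda>z. \<Phi> z * w (snd z))"
    by (rule integrable_Phi_times(1)[OF _ C]) auto
  then have "integrable (lborel \<Otimes>\<^sub>M lborel) (\<lambda>(x, y). \<Phi> (x, y) * w y)"
    by (simp add: lborel_prod case_prod_unfold)
  from lborel_pair.integral_snd[OF this] show ?thesis
    by (simp add: marginal_def lborel_prod case_prod_unfold)
qed

lemma integrable_shift_marginal:
  assumes "q \<in> step_functions"
  shows "integrable lborel (\<lambda>y. marginal \<Phi> (y - a) * q y)"
proof -
  note [measurable] = step_functions_measurable[OF assms]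
  obtain C where C: "\<And>x. norm (q x) \<le> C" using assms step_functions_bounded by meson
  have "integrable lborel (\<lambda>y. C * norm (marginal \<Phi> (y - a)))"
    using lborel_integrable_shift[OF integrable_marginal, of a] by simp
  then show ?thesis
  proof (rule Bochner_Integration.integrable_bound)
    have "norm (marginal \<Phi> (y - a) * q y) \<le> C * norm (marginal \<Phi> (y - a))" for y
      using mult_left_mono[OF C[of y], of "norm (marginal \<Phi> (y - a))"]
      by (simp add: norm_mult mult.commute)
    then show "AE y in lborel. norm (marginal \<Phi> (y - a) * q y) \<le> norm (C * norm (marginal \<Phi> (y - a)))"
      by (intro AE_I2) (smt (verit) real_norm_def)
  qed measurable
qed

lemma step_linear_shift_pairing: "step_linear (shift_pairing (marginal \<Phi>) l)"
  unfolding step_linear_def shift_pairing_def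
proof (intro conjI ballI allI)
  fix p q assume "p \<in> step_functions" "q \<in> step_functions"
  then show "(LINT y|lborel. marginal \<Phi> (y - of_int l) * (p y + q y)) =
      (LINT y|lborel. marginal \<Phi> (y - of_int l) * p y) + (LINT y|lborel. marginal \<Phi> (y - of_int l) * q y)"
    by (simp add: distrib_left integrable_shift_marginal)
qed (simp add: mult.left_commute)

lemma step_linear_pairing_snd:
  "p \<in> step_functions \<Longrightarrow> step_linear (bilinear_pairing \<Phi> p)"
  unfolding step_linear_def bilinear_pairing_def
  by (auto simp: distrib_left integrable_pairing mult.left_commute)

lemma step_linear_pairing_fst:
  "q \<in> step_functions \<Longrightarrow> step_linear (\<lambda>p. bilinear_pairing \<Phi> p q)"
  unfolding step_linear_def bilinear_pairing_def
  by (auto simp: distrib_left distrib_right integrable_pairing mult.left_commute mult.assoc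
      integrable_pairing[unfolded mult.assoc])

end

section \<open>Pairings with half-lines: counting the straddling atoms\<close>

lemma card_int_interval_le:
  fixes r R :: real
  assumes "0 \<le> R"
  shows "finite {k::int. \<bar>of_int k - r\<bar> \<le> R}" and "real (card {k::int. \<bar>of_int k - r\<bar> \<le> R}) \<le> 2 * R + 1"
proof -
  have eq: "{k::int. \<bar>of_int k - r\<bar> \<le> R} = {\<lceil>r - R\<rceil>..\<lfloor>r + R\<rfloor>}"
    by (auto simp: le_floor_iff ceiling_le_iff abs_le_iff)
  show "finite {k::int. \<bar>of_int k - r\<bar> \<le> R}" unfolding eq by simp
  show "real (card {k::int. \<bar>of_int k - r\<bar> \<le> R}) \<le> 2 * R + 1"
  proof (cases "\<lceil>r - R\<rceil> \<le> \<lfloor>r + R\<rfloor> + 1")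
    case True
    have "of_int (\<lfloor>r + R\<rfloor> + 1 - \<lceil>r - R\<rceil>) \<le> (2 * R + 1 :: real)"
      using of_int_floor_le[of "r + R"] le_of_int_ceiling[of "r - R"] by linarith
    then show ?thesis unfolding eq using True by (simp add: of_nat_nat)
  qed (use assms in \<open>simp add: eq\<close>)
qed

context box_function
begin

text \<open>In stretched coordinates the atom occupies the strip of half-width \<open>R\<close>
  about \<open>k\<close> and the cut sits at \<open>N * s\<close>. An atom wholly beyond the cut
  contributes nothing. Wholly before it, the indicator is 1 on the support, and integrating out the
  first variable leaves the integral in \<open>orth\<close>. Only a straddling atom needs the
  trivial bound.\<close>

lemma shifted_half_line_pairing:
  fixes k l s N :: real
  assumes q [measurable]: "q \<in> borel_measurable borel" and C: "\<And>y. norm (q y) \<le> C"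
    and N: "0 < N"
    and orth: "(LINT y|lborel. marginal \<Phi> (y - l) * q y) = 0"
  defines "J \<equiv> (LINT z|lborel. \<Phi> (z - (k, l)) * (indicator {..s} (fst z / N) * q (snd z)))"
  shows "norm J \<le> (if \<bar>k - N * s\<bar> \<le> R then C * (LINT z|lborel. norm (\<Phi> z)) else 0)"
proof -
  have J: "J = (LINT z|lborel. \<Phi> z * (indicator {..s} ((fst z + k) / N) * q (snd z + l)))"
    unfolding J_def
    using lborel_integral_shift[of "\<lambda>z. \<Phi> z * (indicator {..s} ((fst z + k) / N) * q (snd z + l))" "(k, l)"]
    by simp
  consider "\<bar>k - N * s\<bar> \<le> R" | "N * s - k < -R" | "N * s - k > R" by linarith
  then show ?thesis
  proof cases
    case 1
    have "norm (indicator {..s} ((fst z + k) / N) * q (snd z + l)) \<le> C" for z :: "real \<times> real"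
      using C[of "snd z + l"] order_trans[OF norm_ge_zero C] by (auto simp: indicator_def)
    then show ?thesis
      using 1 unfolding J by (simp add: integrable_Phi_times(2))
  next
    case 2
    have "\<Phi> z * (indicator {..s} ((fst z + k) / N) * q (snd z + l)) = 0" for z
    proof (cases "(fst z + k) / N \<le> s")
      case True
      then have "fst z + k \<le> N * s" using N by (simp add: field_simps)
      then have "R < \<bar>fst z\<bar>" using 2 by linarith
      then have "\<Phi> z = 0" using supp[of "fst z" "snd z"] by simp
      then show ?thesis by simp
    qed simp
    then have "J = 0" unfolding J by (simp only: Bochner_Integration.integral_zero)
    then show ?thesis using 2 by auto
  next
    case 3
    have "\<Phi> z * (indicator {..s} ((fst z + k) / N) * q (snd z + l)) = \<Phi> z * q (snd z + l)" for z
    proof (cases "(fst z + k) / N \<le> s")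
      case False
      then have "fst z + k > N * s" using N by (simp add: field_simps)
      then have "R < \<bar>fst z\<bar>" using 3 by linarith
      then have "\<Phi> z = 0" using supp[of "fst z" "snd z"] by simp
      then show ?thesis by simp
    qed simp
    then have "J = (LINT z|lborel. \<Phi> z * q (snd z + l))" unfolding J by (simp only:)
    also have "\<dots> = (LINT y|lborel. marginal \<Phi> y * q (y + l))"
      by (rule integral_marginal) (auto intro: C)
    also have "\<dots> = (LINT y|lborel. marginal \<Phi> (y - l) * q y)"
      using lborel_integral_shift[of "\<lambda>y. marginal \<Phi> y * q (y + l)" l] by simp
    finally show ?thesis using orth 3 by auto
  qed
qed

text \<open>Only the boundedly many coefficients whose shifted atom straddles the end point of the half-line
  contribute, and each of them is \<open>O(1 / sqrt N)\<close>.\<close>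

lemma half_line_pairing_zero:
  assumes ref: "refinable_fst \<Phi> L" and q: "q \<in> step_functions"
    and orth: "\<forall>l\<in>{-L..L}. shift_pairing (marginal \<Phi>) l q = 0"
  shows "bilinear_pairing \<Phi> (\<lambda>x. indicator {..s} x) q = 0"
proof (rule ccontr)
  assume nz: "bilinear_pairing \<Phi> (\<lambda>x. indicator {..s} x) q \<noteq> 0"
  define b where "b = norm (bilinear_pairing \<Phi> (\<lambda>x. indicator {..s} x) q)"
  note [measurable] = step_functions_measurable[OF q]
  obtain C where C: "\<And>x. norm (q x) \<le> C" using q step_functions_bounded by meson
  have C0: "0 \<le> C" using order_trans[OF norm_ge_zero C] .
  define D where "D = C * (LINT z|lborel. norm (\<Phi> z))"
  have D0: "0 \<le> D" unfolding D_def using C0 by simp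
  \<comment> \<open>\<open>K\<close> bounds all straddling atoms together: at most
    \<open>2 * R + 1\<close> columns, \<open>card {-L..L}\<close> rows, and \<open>D\<close> for
    each atom. The estimate becomes \<open>N * b \<le> K * sqrt N\<close>, which fails once
    \<open>N > (K / b)\<^sup>2\<close>; so one large \<open>N\<close> replaces a passage to the
    limit.\<close>
  define K where "K = (2 * R + 1) * real (card {-L..L}) * D"
  from ref[unfolded refinable_fst_def, rule_format, of "(K / b)\<^sup>2"]
  obtain N F a where N: "N > (K / b)\<^sup>2" "N > 0" and F: "finite F" "F \<subseteq> UNIV \<times> {-L..L}"
    and a: "\<forall>k\<in>F. norm (a k) \<le> 1"
    and eq: "AE z in lborel. \<Phi> (fst z / N, snd z) =
       of_real (sqrt N) * (\<Sum>k\<in>F. a k * \<Phi> (z - (of_int (fst k), of_int (snd k))))"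
    by blast
  define w where "w = (\<lambda>z::real \<times> real. indicator {..s} (fst z / N) * q (snd z))"
  have [measurable]: "w \<in> borel_measurable borel" unfolding w_def by measurable
  define J where "J = (\<lambda>k::int \<times> int. LINT z|lborel. \<Phi> (z - (of_int (fst k), of_int (snd k))) * w z)"
  have wC: "norm (w z) \<le> C" for z
    using C[of "snd z"] C0 by (auto simp: w_def indicator_def)
  have int: "integrable lborel (\<lambda>z. \<Phi> (z - c) * w z)" for c
  proof -
    have "integrable lborel (\<lambda>z. \<Phi> z * w (z + c))"
      by (rule integrable_Phi_times(1)) (auto intro: wC)
    from lborel_integrable_shift[OF this, of c] show ?thesis by simp
  qed
  have "of_real N * bilinear_pairing \<Phi> (\<lambda>x. indicator {..s} x) q
      = (LINT z|lborel. \<Phi> (fst z / N, snd z) * w z)"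
    unfolding bilinear_pairing_def w_def
    using lborel_integral_scale_fst[OF N(2), of "\<lambda>z. \<Phi> z * indicator {..s} (fst z) * q (snd z)"]
    by (simp add: mult.assoc)
  also have "\<dots> = (LINT z|lborel. (\<Sum>k\<in>F. (of_real (sqrt N) * a k) * (\<Phi> (z - (of_int (fst k), of_int (snd k))) * w z)))"
    by (rule integral_cong_AE) (use eq in \<open>auto simp: sum_distrib_left sum_distrib_right mult.assoc\<close>)
  also have "\<dots> = (\<Sum>k\<in>F. (of_real (sqrt N) * a k) * J k)"
    unfolding J_def using int by simp
  finally have "N * b = norm (\<Sum>k\<in>F. (of_real (sqrt N) * a k) * J k)"
    unfolding b_def using N(2) by (metis norm_mult norm_of_real abs_of_pos)
  also have "\<dots> \<le> (\<Sum>k\<in>F. sqrt N * norm (J k))"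
    by (intro sum_norm_le) (use a N(2) in \<open>auto simp: norm_mult intro!: mult_left_le_one_le\<close>)
  also have "\<dots> \<le> (\<Sum>k\<in>F. if k \<in> {k. \<bar>of_int k - N * s\<bar> \<le> R} \<times> {-L..L} then sqrt N * D else 0)"
  proof (rule sum_mono)
    fix k assume k: "k \<in> F"
    then have l: "snd k \<in> {-L..L}" using F(2) by auto
    have "norm (J k) \<le> (if \<bar>of_int (fst k) - N * s\<bar> \<le> R then D else 0)"
      unfolding J_def w_def D_def
      by (rule shifted_half_line_pairing) (use C N(2) orth l in \<open>auto simp: shift_pairing_def\<close>)
    then show "sqrt N * norm (J k) \<le> (if k \<in> {k. \<bar>of_int k - N * s\<bar> \<le> R} \<times> {-L..L} then sqrt N * D else 0)"
      using l N(2) by (auto simp: mem_Times_iff split: if_splits intro!: mult_left_mono)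
  qed
  also have "\<dots> = real (card (F \<inter> ({k. \<bar>of_int k - N * s\<bar> \<le> R} \<times> {-L..L}))) * (sqrt N * D)"
    using F(1) by (simp add: sum.If_cases)
  also have "\<dots> \<le> ((2 * R + 1) * real (card {-L..L})) * (sqrt N * D)"
  proof (rule mult_right_mono)
    have "card (F \<inter> ({k. \<bar>of_int k - N * s\<bar> \<le> R} \<times> {-L..L})) \<le> card ({k::int. \<bar>of_int k - N * s\<bar> \<le> R} \<times> {-L..L})"
      by (intro card_mono finite_cartesian_product card_int_interval_le R_nonneg) auto
    also have "\<dots> = card {k::int. \<bar>of_int k - N * s\<bar> \<le> R} * card {-L..L}"
      by (rule card_cartesian_product)
    finally have "real (card (F \<inter> ({k. \<bar>of_int k - N * s\<bar> \<le> R} \<times> {-L..L})))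
        \<le> real (card {k::int. \<bar>of_int k - N * s\<bar> \<le> R}) * real (card {-L..L})"
      by (metis of_nat_le_iff of_nat_mult)
    also have "\<dots> \<le> (2 * R + 1) * real (card {-L..L})"
      by (intro mult_right_mono card_int_interval_le R_nonneg) auto
    finally show "real (card (F \<inter> ({k. \<bar>of_int k - N * s\<bar> \<le> R} \<times> {-L..L}))) \<le> (2 * R + 1) * real (card {-L..L})" .
  qed (use D0 N in auto)
  finally have "N * b \<le> K * sqrt N" unfolding K_def by (simp add: mult_ac)
  then have "sqrt N * (sqrt N * b) \<le> sqrt N * K"
    using N(2) by (metis mult.assoc mult.commute real_sqrt_mult_self abs_of_pos)
  then have "sqrt N * b \<le> K" using N(2) by simp
  moreover have "b > 0" unfolding b_def using nz by simp
  ultimately have "sqrt N \<le> K / b" by (simp add: field_simps)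
  moreover have "K / b < sqrt N" using N(1) by (rule real_less_rsqrt)
  ultimately show False by simp
qed

text \<open>When \<open>p\<close> is a half-line, the preceding vanishing result is exactly the
  kernel condition for a combination of the shift pairings. Since the \<open>e l\<close> do not
  depend on \<open>p\<close>, both sides are linear in \<open>p\<close>, and the identity spreads
  from half-lines to all step functions.\<close>

lemma pairing_expansion:
  assumes ref: "refinable_fst \<Phi> L"
  shows "\<exists>e. (\<forall>l\<in>{-L..L}. e l \<in> step_functions) \<and>
    (\<forall>p\<in>step_functions. \<forall>q\<in>step_functions.
      bilinear_pairing \<Phi> p q = (\<Sum>l\<in>{-L..L}. shift_pairing (marginal \<Phi>) l q * bilinear_pairing \<Phi> p (e l)))"
proof -
  let ?v = "shift_pairing (marginal \<Phi>)"
  obtain e where e: "\<forall>l\<in>{-L..L}. e l \<in> step_functions"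
    and exp: "\<And>g q. step_linear g \<Longrightarrow> (\<forall>q\<in>step_functions. (\<forall>l\<in>{-L..L}. ?v l q = 0) \<longrightarrow> g q = 0) \<Longrightarrow>
      q \<in> step_functions \<Longrightarrow> g q = (\<Sum>l\<in>{-L..L}. ?v l q * g (e l))"
    using step_linear_in_span[of "{-L..L}" ?v, OF finite_atLeastAtMost_int step_linear_shift_pairing] by auto
  have "bilinear_pairing \<Phi> p q = (\<Sum>l\<in>{-L..L}. ?v l q * bilinear_pairing \<Phi> p (e l))"
    if p: "p \<in> step_functions" and q: "q \<in> step_functions" for p q
  proof (rule step_linear_eqI[of "\<lambda>p. bilinear_pairing \<Phi> p q" "\<lambda>p. \<Sum>l\<in>{-L..L}. ?v l q * bilinear_pairing \<Phi> p (e l)", OF _ _ _ p])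
    show "step_linear (\<lambda>p. bilinear_pairing \<Phi> p q)" by (rule step_linear_pairing_fst[OF q])
    have "step_linear (\<lambda>p. bilinear_pairing \<Phi> p (e l))" if "l \<in> {-L..L}" for l
      using e that by (intro step_linear_pairing_fst) auto
    then show "step_linear (\<lambda>p. \<Sum>l\<in>{-L..L}. ?v l q * bilinear_pairing \<Phi> p (e l))"
      unfolding step_linear_def by (simp add: sum.distrib distrib_left sum_distrib_left mult.left_commute)
    show "bilinear_pairing \<Phi> (\<lambda>x. indicator {..s} x) q
        = (\<Sum>l\<in>{-L..L}. ?v l q * bilinear_pairing \<Phi> (\<lambda>x. indicator {..s} x) (e l))" for s
      by (rule exp[OF step_linear_pairing_snd[OF step_functions.half_line] _ q])
         (auto intro: half_line_pairing_zero[OF ref])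
  qed
  with e show ?thesis by blast
qed

end

section \<open>Exchange of the coordinates and the finite tensor expansion\<close>

lemma distr_swap_lborel: "distr lborel borel prod.swap = (lborel :: (real \<times> real) measure)"
proof -
  have "distr (lborel \<Otimes>\<^sub>M lborel) (lborel \<Otimes>\<^sub>M lborel) (\<lambda>(x, y). (y, x)) = (lborel \<Otimes>\<^sub>M lborel :: (real \<times> real) measure)"
    by (rule lborel_pair.distr_pair_swap[symmetric])
  then show ?thesis
    unfolding lborel_prod prod.swap_def case_prod_unfold
    by (metis (lifting) distr_cong sets_lborel)
qed

lemma measurable_swap_borel [measurable]:
  "prod.swap \<in> borel_measurable (borel :: (real \<times> real) measure)"
  by (auto intro!: borel_measurable_continuous_onI continuous_intros)

lemma lborel_integral_swap:
  fixes f :: "real \<times> real \<Rightarrow> complex"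
  assumes "f \<in> borel_measurable borel"
  shows "(LINT z|lborel. f (prod.swap z)) = integral\<^sup>L lborel f"
  using integral_distr[of prod.swap lborel borel f] assms by (simp add: distr_swap_lborel)

lemma lborel_integrable_swap:
  fixes f :: "real \<times> real \<Rightarrow> 'b::{banach,second_countable_topology}"
  assumes "integrable lborel f"
  shows "integrable lborel (\<lambda>z. f (prod.swap z))"
  using integrable_distr[of prod.swap lborel borel f] assms by (simp add: distr_swap_lborel)

lemma AE_lborel_swap:
  assumes "AE z in lborel. P z"
  shows "AE z in lborel. P (prod.swap z :: real \<times> real)"
proof -
  have "AE z in distr lborel borel prod.swap. P z"
    using assms unfolding distr_swap_lborel .
  then show ?thesis by (rule AE_distrD[rotated]) measurable
qed

context box_function
begin

lemma box_function_swap: "box_function (\<Phi> \<circ> prod.swap) R"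
proof
  show "\<Phi> \<circ> prod.swap \<in> borel_measurable borel" by measurable
  show "integrable lborel (\<lambda>z. (norm ((\<Phi> \<circ> prod.swap) z))\<^sup>2)"
    using lborel_integrable_swap[OF sq_int] by simp
qed (use R_nonneg supp in auto)

text \<open>The pairing is expanded in the second variable, and each coefficient
  \<open>?b p (e l)\<close> is then expanded in the first by applying the same result to the swapped
  function. What remains are constants, the pairings of \<open>\<Phi>\<close> with
  \<open>d k\<close> and \<open>e l\<close>. Testing on half-lines in both variables compares
  integrals over quadrants, which determine the function almost everywhere.\<close>

lemma tensor_expansion:
  assumes ref1: "refinable_fst \<Phi> L" and ref2: "refinable_fst (\<Phi> \<circ> prod.swap) K"
  shows "\<exists>h. AE z in lborel. \<Phi> z = (\<Sum>k\<in>{-K..K}. \<Sum>l\<in>{-L..L}.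
    h k l * (marginal (\<Phi> \<circ> prod.swap) (fst z - of_int k) * marginal \<Phi> (snd z - of_int l)))"
proof -
  interpret sw: box_function "\<Phi> \<circ> prod.swap" R by (rule box_function_swap)
  let ?u = "marginal (\<Phi> \<circ> prod.swap)" and ?v = "marginal \<Phi>"
  let ?b = "bilinear_pairing \<Phi>"
  have sw: "bilinear_pairing (\<Phi> \<circ> prod.swap) q p = ?b p q"
    if "p \<in> step_functions" "q \<in> step_functions" for p q
  proof -
    note [measurable] = step_functions_measurable[OF that(1)] step_functions_measurable[OF that(2)]
    show ?thesis
      unfolding bilinear_pairing_def
      using lborel_integral_swap[of "\<lambda>z. \<Phi> z * p (fst z) * q (snd z)"]
      by (simp add: mult_ac)
  qed
  obtain e where e: "\<And>l. l \<in> {-L..L} \<Longrightarrow> e l \<in> step_functions"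
    and exp: "\<And>p q. p \<in> step_functions \<Longrightarrow> q \<in> step_functions \<Longrightarrow>
      ?b p q = (\<Sum>l\<in>{-L..L}. shift_pairing ?v l q * ?b p (e l))"
    using pairing_expansion[OF ref1] by blast
  obtain d where d: "\<And>k. k \<in> {-K..K} \<Longrightarrow> d k \<in> step_functions"
    and exp': "\<And>p q. p \<in> step_functions \<Longrightarrow> q \<in> step_functions \<Longrightarrow>
      bilinear_pairing (\<Phi> \<circ> prod.swap) q p
        = (\<Sum>k\<in>{-K..K}. shift_pairing ?u k p * bilinear_pairing (\<Phi> \<circ> prod.swap) q (d k))"
    using sw.pairing_expansion[OF ref2] by blast
  define h where "h = (\<lambda>k l. ?b (d k) (e l))"
  have main: "?b p q = (\<Sum>k\<in>{-K..K}. \<Sum>l\<in>{-L..L}. h k l * (shift_pairing ?u k p * shift_pairing ?v l q))"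
    if p: "p \<in> step_functions" and q: "q \<in> step_functions" for p q
  proof -
    have "?b p (e l) = (\<Sum>k\<in>{-K..K}. shift_pairing ?u k p * h k l)" if l: "l \<in> {-L..L}" for l
    proof -
      have "?b p (e l) = bilinear_pairing (\<Phi> \<circ> prod.swap) (e l) p" using sw[OF p e[OF l]] by simp
      also have "\<dots> = (\<Sum>k\<in>{-K..K}. shift_pairing ?u k p * bilinear_pairing (\<Phi> \<circ> prod.swap) (e l) (d k))"
        by (rule exp'[OF p e[OF l]])
      also have "\<dots> = (\<Sum>k\<in>{-K..K}. shift_pairing ?u k p * h k l)"
        unfolding h_def by (intro sum.cong refl) (simp add: sw d e[OF l])
      finally show ?thesis .
    qed
    then have "?b p q = (\<Sum>l\<in>{-L..L}. shift_pairing ?v l q * (\<Sum>k\<in>{-K..K}. shift_pairing ?u k p * h k l))"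
      unfolding exp[OF p q] by (intro sum.cong refl) simp
    also have "\<dots> = (\<Sum>k\<in>{-K..K}. \<Sum>l\<in>{-L..L}. h k l * (shift_pairing ?u k p * shift_pairing ?v l q))"
      unfolding sum_distrib_left by (subst sum.swap) (simp add: mult_ac)
    finally show ?thesis .
  qed
  define T where "T = (\<lambda>k l z. ?u (fst z - of_int k) * ?v (snd z - of_int l))"
  have intT: "integrable lborel (T k l)" for k l :: int
    unfolding T_def
    using integrable_tensor[OF lborel_integrable_shift[OF sw.integrable_marginal] lborel_integrable_shift[OF integrable_marginal]] .
  let ?D = "\<lambda>z. \<Phi> z - (\<Sum>k\<in>{-K..K}. \<Sum>l\<in>{-L..L}. h k l * T k l z)"
  have "AE z in lborel. ?D z = 0"
  proof (rule AE_zero_if_quadrants)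
    show "integrable lborel ?D"
      using integrable_Phi intT by auto
    fix s t :: real
    let ?i = "\<lambda>z::real \<times> real. indicator {..s} (fst z) * indicator {..t} (snd z) :: complex"
    have T: "integrable lborel (\<lambda>z. T k l z * ?i z)" 
      "(LINT z|lborel. T k l z * ?i z) = shift_pairing ?u k (\<lambda>x. indicator {..s} x) * shift_pairing ?v l (\<lambda>x. indicator {..t} x)"
      for k l
      using integrable_tensor[OF sw.integrable_shift_marginal[OF step_functions.half_line[of s]]
          integrable_shift_marginal[OF step_functions.half_line[of t]], of "of_int k" "of_int l"]
        integral_tensor[OF sw.integrable_shift_marginal[OF step_functions.half_line[of s]]
          integrable_shift_marginal[OF step_functions.half_line[of t]], of "of_int k" "of_int l"]
      unfolding T_def shift_pairing_def by (simp_all add: mult_ac)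
    have P: "integrable lborel (\<lambda>z. \<Phi> z * ?i z)"
      using integrable_pairing[OF step_functions.half_line[of s] step_functions.half_line[of t]]
      by (simp add: mult.assoc)
    have "(LINT z|lborel. ?D z * indicator {..s} (fst z) * indicator {..t} (snd z))
        = (LINT z|lborel. \<Phi> z * ?i z - (\<Sum>k\<in>{-K..K}. \<Sum>l\<in>{-L..L}. h k l * (T k l z * ?i z)))"
      by (simp add: left_diff_distrib sum_distrib_right mult.assoc)
    also have "\<dots> = (LINT z|lborel. \<Phi> z * ?i z)
        - (\<Sum>k\<in>{-K..K}. \<Sum>l\<in>{-L..L}. h k l * (LINT z|lborel. T k l z * ?i z))"
      using P T(1) by simp
    also have "\<dots> = 0"
      using main[OF step_functions.half_line[of s] step_functions.half_line[of t]]
      unfolding T(2) by (simp add: bilinear_pairing_def mult.assoc)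
    finally show "(LINT z|lborel. ?D z * indicator {..s} (fst z) * indicator {..t} (snd z)) = 0" .
  qed
  then show ?thesis unfolding T_def by auto
qed

end

lemma measurable_cnj_borel [measurable]: "cnj \<in> borel_measurable borel"
  by (intro borel_measurable_continuous_onI continuous_intros)

subsection \<open>Orthonormal shifts\<close>

lemma integrable_mult_square_integrable:
  fixes f g :: "'a \<Rightarrow> complex"
  assumes [measurable]: "f \<in> borel_measurable M" "g \<in> borel_measurable M"
    and "integrable M (\<lambda>x. (norm (f x))\<^sup>2)" "integrable M (\<lambda>x. (norm (g x))\<^sup>2)"
  shows "integrable M (\<lambda>x. f x * cnj (g x))"
proof (rule Bochner_Integration.integrable_bound)
  show "integrable M (\<lambda>x. (norm (f x))\<^sup>2 + (norm (g x))\<^sup>2)" using assms by simp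
  have "a * b \<le> \<bar>a\<^sup>2 + b\<^sup>2\<bar>" for a b :: real
    using sum_squares_bound[of a b] zero_le_power2[of a] zero_le_power2[of b] by linarith
  then show "AE x in M. norm (f x * cnj (g x)) \<le> norm ((norm (f x))\<^sup>2 + (norm (g x))\<^sup>2)"
    by (simp add: norm_mult)
qed measurable

text \<open>These are the Fourier coefficients of the periodised squared modulus of the Fourier
  transform of \<open>u\<close>. For \<open>u\<close> of bounded support only finitely many are
  nonzero, so they form a Laurent polynomial, and the argument stays purely algebraic.\<close>

definition autocorrelation :: "(real \<Rightarrow> complex) \<Rightarrow> int \<Rightarrow> complex" where
  "autocorrelation u n = (LINT x|lborel. u x * cnj (u (x - of_int n)))"

lemma autocorrelation_shift:
  assumes [measurable]: "u \<in> borel_measurable borel"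
  shows "(LINT x|lborel. u (x - of_int a) * cnj (u (x - of_int c))) = autocorrelation u (c - a)"
proof -
  have "(\<lambda>x. u x * cnj (u (x - of_int (c - a)))) \<in> borel_measurable borel" by measurable
  from lborel_integral_shift[OF this, of "of_int a"] show ?thesis
    by (simp add: autocorrelation_def)
qed

lemma autocorrelation_zero_neq:
  assumes [measurable]: "u \<in> borel_measurable borel" and i: "integrable lborel (\<lambda>x. (norm (u x))\<^sup>2)"
    and nz: "\<not> (AE x in lborel. u x = 0)"
  shows "autocorrelation u 0 \<noteq> 0"
proof
  assume "autocorrelation u 0 = 0"
  moreover have "autocorrelation u 0 = of_real (LINT x|lborel. (norm (u x))\<^sup>2)"
    by (simp add: autocorrelation_def complex_norm_square[symmetric] del: of_real_power)
  ultimately have "(LINT x|lborel. (norm (u x))\<^sup>2) = 0" by simp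
  then have "AE x in lborel. (norm (u x))\<^sup>2 = 0"
    using integral_nonneg_eq_0_iff_AE[OF i] by simp
  then show False using nz by simp
qed

text \<open>The Laurent polynomials with coefficients \<open>h\<close>, \<open>F\<close>, \<open>G\<close> satisfy
  \<open>h(z,w) h*(z,w) F(z) G(w) = 1\<close>; comparing lexicographically leading exponents shows that \<open>h\<close>, being
  a unit, is a monomial.\<close>

lemma unit_coefficients_singleton:
  fixes h :: "int \<times> int \<Rightarrow> complex" and F G :: "int \<Rightarrow> complex"
  assumes P: "finite P" and nz: "\<exists>a\<in>P. h a \<noteq> 0"
    and F: "F 0 \<noteq> 0" "\<And>n. M < n \<Longrightarrow> F n = 0" and G: "G 0 \<noteq> 0" "\<And>n. M < n \<Longrightarrow> G n = 0"
    and gram: "\<And>m n. (m, n) \<noteq> (0, 0) \<Longrightarrow>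
      (\<Sum>a\<in>P. \<Sum>b\<in>P. h a * cnj (h b) * (F (m + fst b - fst a) * G (n + snd b - snd a))) = 0"
  shows "\<exists>c\<in>P. \<forall>a\<in>P. h a \<noteq> 0 \<longrightarrow> a = c"
proof -
  \<comment> \<open>Since \<open>E 0 \<noteq> 0\<close>, the leading exponent is non-negative; this
    sign is what forces equalities at the end.\<close>
  have top: "\<exists>N\<ge>0. E N \<noteq> 0 \<and> (\<forall>n>N. E n = 0)"
    if E: "E 0 \<noteq> 0" "\<And>n. M < n \<Longrightarrow> E n = 0" for E :: "int \<Rightarrow> complex"
  proof -
    let ?A = "{n. 0 \<le> n \<and> E n \<noteq> 0}"
    have sub: "?A \<subseteq> {0..M}" using E(2) by force
    have fin: "finite ?A" by (rule finite_subset[OF sub]) simp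
    have ne: "?A \<noteq> {}" using E(1) by auto
    have "Max ?A \<in> ?A" using fin ne by (rule Max_in)
    moreover have "E n = 0" if n: "n > Max ?A" for n
    proof (rule ccontr)
      assume "E n \<noteq> 0"
      then have "n \<in> ?A" using n \<open>Max ?A \<in> ?A\<close> by auto
      then show False using Max_ge[OF fin] n by fastforce
    qed
    ultimately show ?thesis by blast
  qed
  obtain N where N: "N \<ge> 0" "F N \<noteq> 0" "\<And>n. n > N \<Longrightarrow> F n = 0" using top[of F] F by blast
  obtain N' where N': "N' \<ge> 0" "G N' \<noteq> 0" "\<And>n. n > N' \<Longrightarrow> G n = 0" using top[of G] G by blast
  define S where "S = {a\<in>P. h a \<noteq> 0}"
  have S: "finite S" "S \<noteq> {}" using P nz by (auto simp: S_def)
  \<comment> \<open>\<open>(k1, l1)\<close> and \<open>(k0, l0)\<close> will be the lexicographic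
    maximum and minimum of the support \<open>S\<close>.\<close>
  define k1 where "k1 = Max (fst ` S)"
  define k0 where "k0 = Min (fst ` S)"
  have k1: "k1 \<in> fst ` S" "\<And>a. a \<in> S \<Longrightarrow> fst a \<le> k1"
    unfolding k1_def using S by (auto intro!: Max_in Max_ge)
  have k0: "k0 \<in> fst ` S" "\<And>a. a \<in> S \<Longrightarrow> k0 \<le> fst a"
    unfolding k0_def using S by (auto intro!: Min_in Min_le)
  let ?R1 = "{l. (k1, l) \<in> S}" and ?R0 = "{l. (k0, l) \<in> S}"
  have R1: "finite ?R1" "?R1 \<noteq> {}"
    using k1(1) finite_subset[of ?R1 "snd ` S"] S(1) by force+
  have R0: "finite ?R0" "?R0 \<noteq> {}"
    using k0(1) finite_subset[of ?R0 "snd ` S"] S(1) by force+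
  define l1 where "l1 = Max ?R1"
  define l0 where "l0 = Min ?R0"
  have l1: "(k1, l1) \<in> S" "\<And>l. (k1, l) \<in> S \<Longrightarrow> l \<le> l1"
    unfolding l1_def using Max_in[OF R1] Max_ge[OF R1(1)] by auto
  have l0: "(k0, l0) \<in> S" "\<And>l. (k0, l) \<in> S \<Longrightarrow> l0 \<le> l"
    unfolding l0_def using Min_in[OF R0] Min_le[OF R0(1)] by auto
  \<comment> \<open>The lexicographically highest exponent that the product can reach. A nonzero
    term needs \<open>fst a - fst b \<ge> k1 - k0\<close>, which pins both first coordinates; the
    second coordinates are then pinned in the same way. Exactly one term survives, so nothing can
    cancel it.\<close>
  define m where "m = N + k1 - k0"
  define n where "n = N' + l1 - l0"
  define t where "t = (\<lambda>(a, b). h a * cnj (h b) * (F (m + fst b - fst a) * G (n + snd b - snd a)))"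
  have zero: "t (a, b) = 0" if "a \<in> P" "b \<in> P" "(a, b) \<noteq> ((k1, l1), (k0, l0))" for a b
  proof (rule ccontr)
    assume t: "t (a, b) \<noteq> 0"
    then have ab: "a \<in> S" "b \<in> S" "F (m + fst b - fst a) \<noteq> 0" "G (n + snd b - snd a) \<noteq> 0"
      using that by (auto simp: t_def S_def)
    have "m + fst b - fst a \<le> N" using ab(3) N(3) not_le by blast
    then have "fst a = k1" "fst b = k0" using k1(2)[OF ab(1)] k0(2)[OF ab(2)] by (auto simp: m_def)
    moreover from this have "snd a \<le> l1" "l0 \<le> snd b" using l1(2) l0(2) ab(1,2) by (metis prod.collapse)+
    moreover have "n + snd b - snd a \<le> N'" using ab(4) N'(3) not_le by blast
    ultimately have "fst a = k1" "fst b = k0" "snd a = l1" "snd b = l0" by (auto simp: n_def)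
    then have "a = (k1, l1)" "b = (k0, l0)" by (auto simp: prod_eq_iff)
    then show False using that(3) by simp
  qed
  have "(\<Sum>a\<in>P. \<Sum>b\<in>P. h a * cnj (h b) * (F (m + fst b - fst a) * G (n + snd b - snd a)))
      = (\<Sum>ab\<in>P \<times> P. t ab)"
    unfolding sum.cartesian_product t_def by (simp add: case_prod_unfold)
  also have "\<dots> = (\<Sum>ab\<in>{((k1, l1), (k0, l0))}. t ab)"
  proof (rule sum.mono_neutral_right)
    show "{((k1, l1), (k0, l0))} \<subseteq> P \<times> P" using l1(1) l0(1) by (auto simp: S_def)
    show "\<forall>ab\<in>P \<times> P - {((k1, l1), (k0, l0))}. t ab = 0" using zero by auto
  qed (use P in simp)
  also have "\<dots> \<noteq> 0"
    using l1(1) l0(1) N(2) N'(2) by (simp add: t_def S_def m_def n_def)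
  finally have "(m, n) = (0, 0)" using gram[of m n] by blast
  then have mn: "m = 0" "n = 0" by auto
  have "k0 \<le> k1" using k0(2)[OF l1(1)] by simp
  then have k: "k0 = k1" using mn N(1) by (simp add: m_def)
  \<comment> \<open>The inequality \<open>l0 \<le> l1\<close> becomes available only now: before
    \<open>k0 = k1\<close> is known, the two numbers refer to possibly different columns of
    \<open>S\<close>.\<close>
  have l: "l0 = l1" using mn N'(1) l0(2)[of l1] l1(1) k by (simp add: n_def)
  have "a = (k1, l1)" if "a \<in> S" for a
  proof -
    have "fst a = k1" using k0(2)[OF that] k1(2)[OF that] k by simp
    moreover have "snd a = l1"
      using l0(2)[of "snd a"] l1(2)[of "snd a"] that k l \<open>fst a = k1\<close> by (metis order_antisym prod.collapse)
    ultimately show ?thesis by (simp add: prod_eq_iff)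
  qed
  moreover have "(k1, l1) \<in> P" using l1(1) by (simp add: S_def)
  ultimately show ?thesis unfolding S_def by blast
qed

context box_function
begin

text \<open>Cauchy-Schwarz on horizontal slices, which have length at most \<open>2 * R\<close>. The
  constant \<open>2 * R + 1\<close> replaces that length so that the division below is harmless when
  \<open>R = 0\<close>.\<close>

lemma marginal_square_integrable: "integrable lborel (\<lambda>y. (norm (marginal \<Phi> y))\<^sup>2)"
proof (rule Bochner_Integration.integrable_bound)
  show "integrable lborel (\<lambda>y. (2 * R + 1) * (LINT x|lborel. (norm (\<Phi> (x, y)))\<^sup>2))"
    using lborel_pair.integrable_snd[of "\<lambda>x y. (norm (\<Phi> (x, y)))\<^sup>2"] sq_int
    by (simp add: lborel_prod case_prod_unfold)
  have "AE y in lborel. integrable lborel (\<lambda>x. (norm (\<Phi> (x, y)))\<^sup>2)"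
    using lborel_pair.AE_integrable_snd[of "\<lambda>x y. (norm (\<Phi> (x, y)))\<^sup>2"] sq_int
    by (simp add: lborel_prod case_prod_unfold)
  moreover have "AE y in lborel. integrable lborel (\<lambda>x. \<Phi> (x, y))"
    using lborel_pair.AE_integrable_snd[of "\<lambda>x y. \<Phi> (x, y)"] integrable_Phi
    by (simp add: lborel_prod)
  ultimately show "AE y in lborel. norm ((norm (marginal \<Phi> y))\<^sup>2)
      \<le> norm ((2 * R + 1) * (LINT x|lborel. (norm (\<Phi> (x, y)))\<^sup>2))"
  proof eventually_elim
    case (elim y)
    define s where "s = (LINT x|lborel. (norm (\<Phi> (x, y)))\<^sup>2)"
    define a where "a = (LINT x|lborel. norm (\<Phi> (x, y)))"
    define c where "c = 2 * R + 1"
    have c: "1 \<le> c" using R_nonneg by (simp add: c_def)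
    have s0: "0 \<le> s" and a0: "0 \<le> a" unfolding s_def a_def by simp_all
    have le_a: "norm (marginal \<Phi> y) \<le> a"
      unfolding marginal_def a_def by (rule integral_norm_bound)
    \<comment> \<open>This choice maximises \<open>2 * m * a - m\<^sup>2 * c\<close>, with value
      \<open>a\<^sup>2 / c\<close>; it turns the elementary bound on \<open>2 * m * t\<close> into
      Cauchy-Schwarz.\<close>
    define m where "m = a / c"
    have ind: "integrable lborel (\<lambda>x. m\<^sup>2 * indicator {-R..R} x :: real)"
      using R_nonneg by (intro integrable_mult_right integrable_real_indicator) auto
    have "(LINT x|lborel. 2 * m * norm (\<Phi> (x, y)))
        \<le> (LINT x|lborel. (norm (\<Phi> (x, y)))\<^sup>2 + m\<^sup>2 * indicator {-R..R} x)"
    proof (rule integral_mono)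
      fix x :: real
      have "2 * m * t \<le> t\<^sup>2 + m\<^sup>2" for t
        using zero_le_power2[of "t - m"] by (simp add: power2_diff algebra_simps)
      then show "2 * m * norm (\<Phi> (x, y)) \<le> (norm (\<Phi> (x, y)))\<^sup>2 + m\<^sup>2 * indicator {-R..R} x"
        using supp[of x y] by (cases "\<bar>x\<bar> \<le> R") (auto simp: indicator_def)
    qed (use elim ind in auto)
    then have "2 * m * a \<le> s + m\<^sup>2 * (2 * R)"
      using elim ind R_nonneg unfolding a_def s_def by simp
    also have "m\<^sup>2 * (2 * R) \<le> m\<^sup>2 * c" by (intro mult_left_mono) (auto simp: c_def)
    finally have "2 * m * a \<le> s + m\<^sup>2 * c" by simp
    then have "a\<^sup>2 / c \<le> s" using c by (simp add: m_def power2_eq_square)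
    then have "a\<^sup>2 \<le> c * s" using c by (simp add: field_simps)
    moreover have "(norm (marginal \<Phi> y))\<^sup>2 \<le> a\<^sup>2" using le_a by (intro power_mono) auto
    ultimately show ?case using s0 c unfolding s_def[symmetric] c_def[symmetric] by simp
  qed
qed simp

lemma autocorrelation_marginal_zero:
  assumes "2 * R < \<bar>of_int n\<bar>"
  shows "autocorrelation (marginal \<Phi>) n = 0"
proof -
  have "marginal \<Phi> x * cnj (marginal \<Phi> (x - of_int n)) = 0" for x
    using assms marginal_supp[of x] marginal_supp[of "x - of_int n"] by (cases "\<bar>x\<bar> \<le> R") auto
  then show ?thesis unfolding autocorrelation_def by (simp only: Bochner_Integration.integral_zero)
qed

text \<open>Once the tensor expansion is inserted, every Gram integral of the shifts splits into an
  autocorrelation of \<open>u\<close> times one of \<open>v\<close>. Orthonormality is thereby a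
  finite identity between coefficients, which leaves a single nonzero \<open>h\<close>, and
  \<open>\<Phi>\<close> becomes one shifted product of its marginals.\<close>

lemma tensor_product_if_refinable:
  assumes ref1: "refinable_fst \<Phi> L" and ref2: "refinable_fst (\<Phi> \<circ> prod.swap) K"
    and orth: "\<And>m n :: int. (LINT z|lborel. \<Phi> z * cnj (\<Phi> (z - (of_int m, of_int n))))
      = (if m = 0 \<and> n = 0 then 1 else 0)"
  shows "\<exists>f1 f2. f1 \<in> borel_measurable borel \<and> f2 \<in> borel_measurable borel \<and>
    integrable lborel (\<lambda>x. (norm (f1 x))\<^sup>2) \<and> integrable lborel (\<lambda>y. (norm (f2 y))\<^sup>2) \<and>
    (AE z in lborel. \<Phi> z = f1 (fst z) * f2 (snd z))"
proof -
  interpret sw: box_function "\<Phi> \<circ> prod.swap" R by (rule box_function_swap)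
  define u where "u = marginal (\<Phi> \<circ> prod.swap)"
  define v where "v = marginal \<Phi>"
  have [measurable]: "u \<in> borel_measurable borel" "v \<in> borel_measurable borel"
    unfolding u_def v_def by (rule sw.marginal_measurable marginal_measurable)+
  have u2: "integrable lborel (\<lambda>x. (norm (u x))\<^sup>2)" and v2: "integrable lborel (\<lambda>x. (norm (v x))\<^sup>2)"
    unfolding u_def v_def by (rule sw.marginal_square_integrable marginal_square_integrable)+
  define P where "P = {-K..K} \<times> {-L..L}"
  define T where "T = (\<lambda>a::int \<times> int. \<lambda>z. u (fst z - of_int (fst a)) * v (snd z - of_int (snd a)))"
  have [measurable]: "T a \<in> borel_measurable borel" for a unfolding T_def by measurable
  have Tz: "{z \<in> space (lborel \<Otimes>\<^sub>M lborel). T a z = 0} \<in> sets (lborel \<Otimes>\<^sub>M lborel)" for a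
    unfolding lborel_prod by measurable
  obtain h where "AE z in lborel. \<Phi> z = (\<Sum>k\<in>{-K..K}. \<Sum>l\<in>{-L..L}.
      h k l * (u (fst z - of_int k) * v (snd z - of_int l)))"
    using tensor_expansion[OF ref1 ref2] unfolding u_def v_def by blast
  then have exp: "AE z in lborel. \<Phi> z = (\<Sum>a\<in>P. case_prod h a * T a z)"
    unfolding P_def T_def sum.cartesian_product by (simp add: case_prod_unfold)
  \<comment> \<open>The unit norm of \<open>\<Phi>\<close> is the source of all three nonvanishing
    facts below, for \<open>u\<close>, \<open>v\<close> and \<open>h\<close>: the expansion would
    make \<open>\<Phi>\<close> vanish if any of them did.\<close>
  have not0: "\<not> (AE z in lborel. \<Phi> z = 0)"
  proof
    assume "AE z in lborel. \<Phi> z = 0"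
    then have "AE z in lborel. \<Phi> z * cnj (\<Phi> z) = 0" by auto
    then have "(LINT z|lborel. \<Phi> z * cnj (\<Phi> z)) = 0" by (rule integral_eq_zero_AE)
    then show False using orth[of 0 0] by (simp add: zero_prod_def[symmetric])
  qed
  have T2: "integrable lborel (\<lambda>z. T a z * cnj (T b (z - (of_int m, of_int n))))"
    "(LINT z|lborel. T a z * cnj (T b (z - (of_int m, of_int n))))
      = autocorrelation u (m + fst b - fst a) * autocorrelation v (n + snd b - snd a)" for a b m n
  proof -
    have s: "integrable lborel (\<lambda>x. w (x - c) * cnj (w (x - d)))"
      if [measurable]: "w \<in> borel_measurable borel" and w: "integrable lborel (\<lambda>x. (norm (w x))\<^sup>2)"
      for w :: "real \<Rightarrow> complex" and c d
      using lborel_integrable_shift[OF w] by (intro integrable_mult_square_integrable) auto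
    have eq: "T a z * cnj (T b (z - (of_int m, of_int n)))
      = (u (fst z - of_int (fst a)) * cnj (u (fst z - of_int (m + fst b))))
        * (v (snd z - of_int (snd a)) * cnj (v (snd z - of_int (n + snd b))))" for z
      by (simp add: T_def algebra_simps)
    show "integrable lborel (\<lambda>z. T a z * cnj (T b (z - (of_int m, of_int n))))"
      unfolding eq by (rule integrable_tensor) (rule s; fact)+
    show "(LINT z|lborel. T a z * cnj (T b (z - (of_int m, of_int n))))
      = autocorrelation u (m + fst b - fst a) * autocorrelation v (n + snd b - snd a)"
      unfolding eq
      by (subst integral_tensor, (rule s; fact)+)
         (simp only: autocorrelation_shift \<open>u \<in> borel_measurable borel\<close> \<open>v \<in> borel_measurable borel\<close>)
  qed
  have gram: "(\<Sum>a\<in>P. \<Sum>b\<in>P. case_prod h a * cnj (case_prod h b) *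
      (autocorrelation u (m + fst b - fst a) * autocorrelation v (n + snd b - snd a))) = 0"
    if "(m, n) \<noteq> (0, 0)" for m n
  proof -
    have "AE z in lborel. \<Phi> (z - (of_int m, of_int n)) = (\<Sum>a\<in>P. case_prod h a * T a (z - (of_int m, of_int n)))"
      by (rule AE_lborel_shift[OF exp])
    with exp have "AE z in lborel. \<Phi> z * cnj (\<Phi> (z - (of_int m, of_int n)))
        = (\<Sum>a\<in>P. \<Sum>b\<in>P. case_prod h a * cnj (case_prod h b) * (T a z * cnj (T b (z - (of_int m, of_int n)))))"
    proof eventually_elim
      case (elim z)
      show ?case unfolding elim(2) unfolding elim(1) cnj_sum sum_product by (simp add: mult_ac)
    qed
    then have "(LINT z|lborel. \<Phi> z * cnj (\<Phi> (z - (of_int m, of_int n))))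
        = (LINT z|lborel. (\<Sum>a\<in>P. \<Sum>b\<in>P. case_prod h a * cnj (case_prod h b) * (T a z * cnj (T b (z - (of_int m, of_int n))))))"
      by (intro integral_cong_AE) measurable
    then show ?thesis using T2 orth[of m n] that by auto
  qed
  have u0: "autocorrelation u 0 \<noteq> 0"
  proof (rule autocorrelation_zero_neq[OF _ u2], measurable, rule notI)
    assume "AE x in lborel. u x = 0"
    then have "AE x in lborel. u (x - of_int k) = 0" for k :: int by (rule AE_lborel_shift)
    then have "AE x in lborel. AE y in lborel. T a (x, y) = 0" for a by (auto simp: T_def)
    then have "AE z in lborel \<Otimes>\<^sub>M lborel. T a z = 0" for a
      by (intro lborel_pair.AE_pair_measure Tz)
    then have "AE z in lborel. T a z = 0" for a
      unfolding lborel_prod .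
    then have "AE z in lborel. \<forall>a\<in>P. T a z = 0"
      by (intro AE_finite_allI) (auto simp: P_def)
    with exp have "AE z in lborel. \<Phi> z = 0" by eventually_elim simp
    then show False using not0 by simp
  qed
  have v0: "autocorrelation v 0 \<noteq> 0"
  proof (rule autocorrelation_zero_neq[OF _ v2], measurable, rule notI)
    assume "AE x in lborel. v x = 0"
    then have "AE x in lborel. v (x - of_int k) = 0" for k :: int by (rule AE_lborel_shift)
    then have "AE x in lborel. AE y in lborel. T a (x, y) = 0" for a by (auto simp: T_def)
    then have "AE z in lborel \<Otimes>\<^sub>M lborel. T a z = 0" for a
      by (intro lborel_pair.AE_pair_measure Tz)
    then have "AE z in lborel. T a z = 0" for a
      unfolding lborel_prod .
    then have "AE z in lborel. \<forall>a\<in>P. T a z = 0"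
      by (intro AE_finite_allI) (auto simp: P_def)
    with exp have "AE z in lborel. \<Phi> z = 0" by eventually_elim simp
    then show False using not0 by simp
  qed
  have nz: "\<exists>a\<in>P. case_prod h a \<noteq> 0"
  proof (rule ccontr)
    assume "\<not> ?thesis"
    then have "AE z in lborel. \<Phi> z = 0" using exp by simp
    then show False using not0 by simp
  qed
  have "\<exists>c\<in>P. \<forall>a\<in>P. case_prod h a \<noteq> 0 \<longrightarrow> a = c"
  proof (rule unit_coefficients_singleton[where F = "autocorrelation u" and G = "autocorrelation v" and M = "\<lceil>2 * R\<rceil>"])
    \<comment> \<open>The marginals live on an interval of length \<open>2 * R\<close>, so longer
      shifts do not overlap the original.\<close>
    show "autocorrelation u n = 0" "autocorrelation v n = 0" if "\<lceil>2 * R\<rceil> < n" for n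
      using that sw.autocorrelation_marginal_zero[of n] autocorrelation_marginal_zero[of n]
      unfolding u_def v_def by (simp_all add: ceiling_less_iff)
  qed (use nz u0 v0 gram in \<open>auto simp: P_def\<close>)
  then obtain c where c: "c \<in> P" "\<And>a. a \<in> P \<Longrightarrow> a \<noteq> c \<Longrightarrow> case_prod h a = 0" by blast
  have "(\<Sum>a\<in>P. case_prod h a * T a z) = case_prod h c * T c z" for z
  proof -
    have "(\<Sum>a\<in>P. case_prod h a * T a z) = (\<Sum>a\<in>{c}. case_prod h a * T a z)"
      by (rule sum.mono_neutral_right) (use c in \<open>auto simp: P_def\<close>)
    then show ?thesis by simp
  qed
  with exp have ae: "AE z in lborel. \<Phi> z = (case_prod h c * u (fst z - of_int (fst c))) * v (snd z - of_int (snd c))"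
    by (simp add: T_def mult.assoc)
  show ?thesis
  proof (intro exI conjI)
    show "AE z in lborel. \<Phi> z = (\<lambda>x. case_prod h c * u (x - of_int (fst c))) (fst z)
        * (\<lambda>y. v (y - of_int (snd c))) (snd z)" using ae by simp
    show "integrable lborel (\<lambda>x. (norm (case_prod h c * u (x - of_int (fst c))))\<^sup>2)"
      using lborel_integrable_shift[OF u2, of "of_int (fst c)"] by (simp add: norm_mult power_mult_distrib)
    show "integrable lborel (\<lambda>y. (norm (v (y - of_int (snd c))))\<^sup>2)"
      by (rule lborel_integrable_shift[OF v2])
  qed measurable
qed

end

subsection \<open>Expansion in an orthonormal basis of a subspace\<close>

lemma L2_space_add:
  assumes f: "f \<in> L2_space" and g: "g \<in> L2_space"
  shows "(\<lambda>x. f x + g x) \<in> L2_space"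
proof -
  have m [measurable]: "f \<in> borel_measurable lebesgue" "g \<in> borel_measurable lebesgue"
    and i: "integrable lebesgue (\<lambda>x. (norm (f x))\<^sup>2)" "integrable lebesgue (\<lambda>x. (norm (g x))\<^sup>2)"
    using f g by (auto simp: L2_space_def)
  have le: "(norm (f x + g x))\<^sup>2 \<le> 2 * (norm (f x))\<^sup>2 + 2 * (norm (g x))\<^sup>2" for x
  proof -
    have "(norm (f x + g x))\<^sup>2 \<le> (norm (f x) + norm (g x))\<^sup>2"
      by (rule power_mono[OF norm_triangle_ineq norm_ge_zero])
    also have "\<dots> = (norm (f x))\<^sup>2 + (norm (g x))\<^sup>2 + 2 * norm (f x) * norm (g x)"
      by (rule power2_sum)
    also have "\<dots> \<le> 2 * (norm (f x))\<^sup>2 + 2 * (norm (g x))\<^sup>2"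
      using sum_squares_bound[of "norm (f x)" "norm (g x)"] by linarith
    finally show ?thesis .
  qed
  have "integrable lebesgue (\<lambda>x. (norm (f x + g x))\<^sup>2)"
  proof (rule Bochner_Integration.integrable_bound)
    show "integrable lebesgue (\<lambda>x. 2 * (norm (f x))\<^sup>2 + 2 * (norm (g x))\<^sup>2)" using i by simp
    show "AE x in lebesgue. norm ((norm (f x + g x))\<^sup>2) \<le> norm (2 * (norm (f x))\<^sup>2 + 2 * (norm (g x))\<^sup>2)"
      using le by (intro AE_I2) (simp add: order_trans[OF le abs_ge_self])
  qed measurable
  then show ?thesis by (simp add: L2_space_def)
qed

lemma L2_space_scale: "f \<in> L2_space \<Longrightarrow> (\<lambda>x. c * f x) \<in> L2_space"
  by (auto simp: L2_space_def norm_mult power_mult_distrib)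

lemma L2_space_sum:
  assumes "finite F" "\<And>i. i \<in> F \<Longrightarrow> e i \<in> L2_space"
  shows "(\<lambda>x. \<Sum>i\<in>F. c i * e i x) \<in> L2_space"
  using assms
proof (induction F)
  case empty
  show ?case by (simp add: L2_space_def)
next
  case (insert i F)
  then show ?case by (simp add: L2_space_add L2_space_scale)
qed

lemma L2_space_diff: "f \<in> L2_space \<Longrightarrow> g \<in> L2_space \<Longrightarrow> (\<lambda>x. f x - g x) \<in> L2_space"
  using L2_space_add[of f "\<lambda>x. (-1) * g x"] L2_space_scale[of g "-1"] by simp

lemma L2_inner_integrable:
  "f \<in> L2_space \<Longrightarrow> g \<in> L2_space \<Longrightarrow> integrable lebesgue (\<lambda>x. f x * cnj (g x))"
  by (rule integrable_mult_square_integrable) (auto simp: L2_space_def)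

lemma L2_inner_commute: "L2_inner g f = cnj (L2_inner f g)"
  unfolding L2_inner_def
  by (subst Bochner_Integration.integral_cnj[symmetric]) (simp add: mult.commute)

lemma L2_inner_diff_left:
  assumes "f \<in> L2_space" "g \<in> L2_space" "h \<in> L2_space"
  shows "L2_inner (\<lambda>x. f x - g x) h = L2_inner f h - L2_inner g h"
  unfolding L2_inner_def left_diff_distrib
  by (intro Bochner_Integration.integral_diff L2_inner_integrable assms)

lemma L2_inner_diff_right:
  assumes "f \<in> L2_space" "g \<in> L2_space" "h \<in> L2_space"
  shows "L2_inner h (\<lambda>x. f x - g x) = L2_inner h f - L2_inner h g"
  unfolding L2_inner_def right_diff_distrib complex_cnj_diff
  by (intro Bochner_Integration.integral_diff L2_inner_integrable assms)

lemma L2_inner_sum_left: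
  assumes e: "\<And>i. i \<in> F \<Longrightarrow> e i \<in> L2_space" and h: "h \<in> L2_space"
  shows "L2_inner (\<lambda>x. \<Sum>i\<in>F. c i * e i x) h = (\<Sum>i\<in>F. c i * L2_inner (e i) h)"
proof -
  have int: "integrable lebesgue (\<lambda>x. e i x * cnj (h x))" if "i \<in> F" for i
    by (rule L2_inner_integrable[OF e[OF that] h])
  show ?thesis
    unfolding L2_inner_def sum_distrib_right mult.assoc
    by (subst Bochner_Integration.integral_sum) (auto simp: int)
qed

lemma L2_inner_self: "L2_inner f f = of_real ((L2_norm f)\<^sup>2)"
  by (simp add: L2_inner_def L2_norm_def complex_norm_square[symmetric] del: of_real_power)

text \<open>Pythagoras with free coefficients: the choice \<open>c i = L2_inner f (e i)\<close> is
  optimal, and the last sum is the exact price of any other choice.\<close>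

lemma L2_norm_sub_orthonormal:
  assumes F: "finite F" and e: "\<And>i. i \<in> F \<Longrightarrow> e i \<in> L2_space" and f: "f \<in> L2_space"
    and orth: "\<And>i j. i \<in> F \<Longrightarrow> j \<in> F \<Longrightarrow> L2_inner (e i) (e j) = (if i = j then 1 else 0)"
  shows "(L2_norm (\<lambda>x. f x - (\<Sum>i\<in>F. c i * e i x)))\<^sup>2
    = (L2_norm f)\<^sup>2 - (\<Sum>i\<in>F. (norm (L2_inner f (e i)))\<^sup>2) + (\<Sum>i\<in>F. (norm (c i - L2_inner f (e i)))\<^sup>2)"
proof -
  define g where "g = (\<lambda>x. \<Sum>i\<in>F. c i * e i x)"
  let ?a = "\<lambda>i. L2_inner f (e i)"
  have g: "g \<in> L2_space" unfolding g_def by (rule L2_space_sum[OF F e])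
  have gf: "L2_inner g f = (\<Sum>i\<in>F. c i * cnj (?a i))"
    unfolding g_def by (subst L2_inner_sum_left[OF e f]) (auto simp: L2_inner_commute[of f])
  have ge: "L2_inner (e j) g = cnj (c j)" if "j \<in> F" for j
  proof -
    have "L2_inner g (e j) = (\<Sum>i\<in>F. c i * L2_inner (e i) (e j))"
      unfolding g_def by (rule L2_inner_sum_left[OF e e[OF that]])
    also have "\<dots> = (\<Sum>i\<in>F. if i = j then c i else 0)"
      using orth that by (intro sum.cong) auto
    finally show ?thesis using that F by (simp add: L2_inner_commute[of "e j" g])
  qed
  have gg: "L2_inner g g = (\<Sum>i\<in>F. c i * cnj (c i))"
  proof -
    have "L2_inner g g = (\<Sum>i\<in>F. c i * L2_inner (e i) g)"
      unfolding g_def by (rule L2_inner_sum_left[OF e g[unfolded g_def]])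
    then show ?thesis by (simp add: ge)
  qed
  have "complex_of_real ((L2_norm (\<lambda>x. f x - g x))\<^sup>2) = L2_inner (\<lambda>x. f x - g x) (\<lambda>x. f x - g x)"
    by (rule L2_inner_self[symmetric])
  also have "\<dots> = L2_inner f f - cnj (L2_inner g f) - L2_inner g f + L2_inner g g"
    using f g by (simp add: L2_inner_diff_left L2_inner_diff_right L2_space_diff L2_inner_commute[of f g])
  also have "\<dots> = L2_inner f f + (\<Sum>i\<in>F. c i * cnj (c i) - cnj (c i) * ?a i - c i * cnj (?a i))"
    unfolding gf gg by (simp add: sum_subtractf)
  also have "(\<Sum>i\<in>F. c i * cnj (c i) - cnj (c i) * ?a i - c i * cnj (?a i))
      = (\<Sum>i\<in>F. of_real ((norm (c i - ?a i))\<^sup>2) - of_real ((norm (?a i))\<^sup>2))"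
    unfolding complex_norm_square by (intro sum.cong) (auto simp: algebra_simps)
  finally have "complex_of_real ((L2_norm (\<lambda>x. f x - g x))\<^sup>2)
      = of_real ((L2_norm f)\<^sup>2 + (\<Sum>i\<in>F. (norm (c i - ?a i))\<^sup>2 - (norm (?a i))\<^sup>2))"
    by (simp add: L2_inner_self del: of_real_power) 
  then have "(L2_norm (\<lambda>x. f x - g x))\<^sup>2 = (L2_norm f)\<^sup>2 + (\<Sum>i\<in>F. (norm (c i - ?a i))\<^sup>2 - (norm (?a i))\<^sup>2)"
    by (rule of_real_eq_iff[THEN iffD1])
  then show ?thesis unfolding g_def by (simp add: sum_subtractf)
qed

lemma L2_norm_zero_AE:
  assumes "f \<in> L2_space" "L2_norm f = 0"
  shows "AE x in lebesgue. f x = 0"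
proof -
  have "(LINT x|lebesgue. (norm (f x))\<^sup>2) = 0" using assms(2) by (simp add: L2_norm_def)
  then have "AE x in lebesgue. (norm (f x))\<^sup>2 = 0"
    using assms(1) by (subst (asm) integral_nonneg_eq_0_iff_AE) (auto simp: L2_space_def)
  then show ?thesis by simp
qed

lemma L2_closureD: "f \<in> L2_closure S \<Longrightarrow> \<epsilon> > 0 \<Longrightarrow> \<exists>g\<in>S. L2_norm (\<lambda>x. f x - g x) < \<epsilon>"
  by (simp add: L2_closure_def)

text \<open>No infinite series is involved. As the coefficients vanish off \<open>\<Lambda>\<close>,
  no finite combination of basis elements is closer to \<open>f\<close> than the sum over
  \<open>\<Lambda>\<close>, whatever its index set; density of such combinations makes the residual
  \<open>r\<close> zero. The bound on the coefficients is Bessel's inequality.\<close>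

lemma orthonormal_basis_finite_expansion:
  assumes onb: "L2_orthonormal_basis I e S" and f: "f \<in> S" and L: "finite \<Lambda>" "\<Lambda> \<subseteq> I"
    and zero: "\<And>i. i \<in> I - \<Lambda> \<Longrightarrow> L2_inner f (e i) = 0"
  shows "AE x in lebesgue. f x = (\<Sum>i\<in>\<Lambda>. L2_inner f (e i) * e i x)"
    and "\<And>i. i \<in> \<Lambda> \<Longrightarrow> norm (L2_inner f (e i)) \<le> L2_norm f"
proof -
  let ?a = "\<lambda>i. L2_inner f (e i)"
  have S: "S \<subseteq> L2_space" using onb by (auto simp: L2_orthonormal_basis_def L2_closure_def)
  have e: "\<And>i. i \<in> I \<Longrightarrow> e i \<in> L2_space" using onb S by (auto simp: L2_orthonormal_basis_def)
  have fL: "f \<in> L2_space" using f S by auto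
  have orth: "\<And>i j. i \<in> I \<Longrightarrow> j \<in> I \<Longrightarrow> L2_inner (e i) (e j) = (if i = j then 1 else 0)"
    using onb by (auto simp: L2_orthonormal_basis_def)
  have pyth: "(L2_norm (\<lambda>x. f x - (\<Sum>i\<in>F. c i * e i x)))\<^sup>2
    = (L2_norm f)\<^sup>2 - (\<Sum>i\<in>F. (norm (?a i))\<^sup>2) + (\<Sum>i\<in>F. (norm (c i - ?a i))\<^sup>2)"
    if "finite F" "F \<subseteq> I" for F c
  proof (rule L2_norm_sub_orthonormal[OF that(1) _ fL])
    show "L2_inner (e i) (e j) = (if i = j then 1 else 0)" if "i \<in> F" "j \<in> F" for i j
      using that \<open>F \<subseteq> I\<close> by (intro orth) auto
  qed (use that e in auto)
  define r where "r = (L2_norm (\<lambda>x. f x - (\<Sum>i\<in>\<Lambda>. ?a i * e i x)))\<^sup>2"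
  have r: "r = (L2_norm f)\<^sup>2 - (\<Sum>i\<in>\<Lambda>. (norm (?a i))\<^sup>2)"
    unfolding r_def using pyth[OF L, of ?a] by simp
  have "r \<le> \<epsilon>\<^sup>2" if "\<epsilon> > 0" for \<epsilon>
  proof -
    have "f \<in> L2_closure {\<lambda>x. \<Sum>i\<in>F. c i * e i x | F c. finite F \<and> F \<subseteq> I}"
      using onb f by (simp add: L2_orthonormal_basis_def)
    from L2_closureD[OF this that]
    obtain g where "g \<in> {\<lambda>x. \<Sum>i\<in>F. c i * e i x | F c. finite F \<and> F \<subseteq> I}"
      and g: "L2_norm (\<lambda>x. f x - g x) < \<epsilon>" ..
    then obtain F c where F: "finite F" "F \<subseteq> I" and "g = (\<lambda>x. \<Sum>i\<in>F. c i * e i x)"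
      by auto
    with g have "L2_norm (\<lambda>x. f x - (\<Sum>i\<in>F. c i * e i x)) < \<epsilon>" by simp
    then have "(L2_norm (\<lambda>x. f x - (\<Sum>i\<in>F. c i * e i x)))\<^sup>2 \<le> \<epsilon>\<^sup>2"
      by (intro power_mono) (auto simp: L2_norm_def)
    moreover have "0 \<le> (\<Sum>i\<in>F. (norm (c i - ?a i))\<^sup>2)" by (intro sum_nonneg) auto
    moreover have "(\<Sum>i\<in>F. (norm (?a i))\<^sup>2) \<le> (\<Sum>i\<in>\<Lambda>. (norm (?a i))\<^sup>2)"
    proof -
      have "(\<Sum>i\<in>F. (norm (?a i))\<^sup>2) = (\<Sum>i\<in>F \<inter> \<Lambda>. (norm (?a i))\<^sup>2)"
        using F zero by (intro sum.mono_neutral_right) auto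
      also have "\<dots> \<le> (\<Sum>i\<in>\<Lambda>. (norm (?a i))\<^sup>2)" using L by (intro sum_mono2) auto
      finally show ?thesis .
    qed
    ultimately show ?thesis using pyth[OF F, of c] unfolding r by linarith
  qed
  then have "r \<le> 0 + \<epsilon>" if "\<epsilon> > 0" for \<epsilon>
    using that \<open>\<And>\<epsilon>. \<epsilon> > 0 \<Longrightarrow> r \<le> \<epsilon>\<^sup>2\<close>[of "sqrt \<epsilon>"] by simp
  then have "r \<le> 0" by (rule field_le_epsilon)
  then have "L2_norm (\<lambda>x. f x - (\<Sum>i\<in>\<Lambda>. ?a i * e i x)) = 0"
    unfolding r_def by simp
  moreover have "(\<lambda>x. f x - (\<Sum>i\<in>\<Lambda>. ?a i * e i x)) \<in> L2_space"
    using L e by (intro L2_space_diff fL L2_space_sum) auto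
  ultimately have "AE x in lebesgue. f x - (\<Sum>i\<in>\<Lambda>. ?a i * e i x) = 0"
    by (intro L2_norm_zero_AE)
  then show "AE x in lebesgue. f x = (\<Sum>i\<in>\<Lambda>. ?a i * e i x)" by auto
  have "0 \<le> r" unfolding r_def by simp
  show "norm (?a i) \<le> L2_norm f" if "i \<in> \<Lambda>" for i
  proof -
    have "(norm (?a i))\<^sup>2 \<le> (\<Sum>i\<in>\<Lambda>. (norm (?a i))\<^sup>2)"
      using that L by (intro member_le_sum) auto
    then have "(norm (?a i))\<^sup>2 \<le> (L2_norm f)\<^sup>2" using \<open>0 \<le> r\<close> r by linarith
    then show ?thesis by (rule power2_le_imp_le) (simp add: L2_norm_def)
  qed
qed

subsection \<open>From the plane of vectors to the plane of pairs\<close>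

lemma AE_lborel_scale_fst:
  fixes N :: real and P :: "real \<times> real \<Rightarrow> bool"
  assumes N: "N > 0" and P: "AE z in lborel. P z"
  shows "AE z in lborel. P (fst z / N, snd z)"
proof -
  let ?T = "\<lambda>z::real \<times> real. (1 / N * fst z, snd z)"
  have eq: "(lborel :: (real \<times> real) measure) = density (distr lborel borel ?T) (\<lambda>_. ennreal (1 / N))"
    by (rule lborel_scale_fst) (use N in simp)
  have "AE z in density (distr lborel borel ?T) (\<lambda>_. ennreal (1 / N)). P z"
    by (rule eq[THEN subst[where P = "\<lambda>M. AE z in M. P z"], OF P])
  then have "AE z in distr lborel borel ?T. P z"
    by (subst (asm) AE_density) (use N in simp_all)
  then have "AE z in lborel. P (?T z)"
    by (rule AE_distrD[rotated]) measurable
  then show ?thesis by simp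
qed

text \<open>Two instances are intended, with the coordinates in the given and in the reversed order,
  so that refinability in the first coordinate of pairs serves both dilations. Only measure,
  differences and the integer lattice have to be respected.\<close>

locale plane_chart =
  fixes \<iota> :: "real \<times> real \<Rightarrow> real^2" and \<kappa> :: "real^2 \<Rightarrow> real \<times> real"
  assumes chart_meas [measurable]: "\<iota> \<in> borel \<rightarrow>\<^sub>M borel" "\<kappa> \<in> borel \<rightarrow>\<^sub>M borel"
    and chart_diff: "\<And>z w. \<iota> (z - w) = \<iota> z - \<iota> w"
    and chart_inv [simp]: "\<And>x. \<iota> (\<kappa> x) = x" "\<And>z. \<kappa> (\<iota> z) = z"
    and distr_chart: "distr lborel borel \<iota> = lborel"
    and lattice: "{k. \<forall>n. k $ n \<in> \<int>} = range (\<lambda>(m, n). \<iota> (of_int m, of_int n))"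
begin

lemma distr_chart_inv: "distr lborel borel \<kappa> = lborel"
proof -
  have "distr lborel borel \<kappa> = distr (distr lborel borel \<iota>) borel \<kappa>" by (simp add: distr_chart)
  also have "\<dots> = distr lborel borel (\<kappa> \<circ> \<iota>)" by (rule distr_distr) auto
  also have "\<dots> = distr lborel lborel (\<lambda>z. z)" by (rule distr_cong) auto
  finally show ?thesis by (simp add: distr_id)
qed

lemma AE_chart: "AE x in lebesgue. P x \<Longrightarrow> AE z in lborel. P (\<iota> z)"
  by (rule AE_distrD[of \<iota> lborel borel P, unfolded distr_chart]) (auto simp: AE_completion_iff)

lemma AE_chart_inv: "AE z in lborel. P z \<Longrightarrow> AE x in lebesgue. P (\<kappa> x)"
  unfolding AE_completion_iff
  by (rule AE_distrD[of \<kappa> lborel borel P, unfolded distr_chart_inv]) auto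

lemma
  fixes F :: "real \<times> real \<Rightarrow> 'b::{banach, second_countable_topology}"
  assumes f: "f \<in> borel_measurable lebesgue" and F [measurable]: "F \<in> borel_measurable borel"
    and eq: "AE z in lborel. f (\<iota> z) = F z"
  shows integral_chart: "integral\<^sup>L lebesgue f = integral\<^sup>L lborel F"
    and integrable_chart: "integrable lebesgue f \<longleftrightarrow> integrable lborel F"
proof -
  have eq': "AE x in lebesgue. f x = F (\<kappa> x)" using AE_chart_inv[OF eq] by simp
  have [measurable]: "(\<lambda>x. F (\<kappa> x)) \<in> borel_measurable lebesgue"
    by (rule measurable_completion) measurable
  have "integral\<^sup>L lebesgue f = (LINT x|lebesgue. F (\<kappa> x))"
    using f eq' by (intro integral_cong_AE) auto
  also have "\<dots> = (LINT x|lborel. F (\<kappa> x))" by (rule integral_completion) measurable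
  also have "\<dots> = integral\<^sup>L (distr lborel borel \<kappa>) F" by (rule integral_distr[symmetric]) auto
  finally show "integral\<^sup>L lebesgue f = integral\<^sup>L lborel F" by (simp add: distr_chart_inv)
  have "integrable lebesgue f \<longleftrightarrow> integrable lebesgue (\<lambda>x. F (\<kappa> x))"
    using f eq' by (intro integrable_cong_AE) auto
  also have "\<dots> \<longleftrightarrow> integrable lborel (\<lambda>x. F (\<kappa> x))" by (rule integrable_completion) measurable
  also have "\<dots> \<longleftrightarrow> integrable (distr lborel borel \<kappa>) F" by (rule integrable_distr_eq[symmetric]) auto
  finally show "integrable lebesgue f \<longleftrightarrow> integrable lborel F" by (simp add: distr_chart_inv)
qed

lemma L2_inner_chart:
  assumes "f \<in> L2_space" "g \<in> L2_space"
    and [measurable]: "F \<in> borel_measurable borel" "G \<in> borel_measurable borel"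
    and "AE z in lborel. f (\<iota> z) = F z" "AE z in lborel. g (\<iota> z) = G z"
  shows "L2_inner f g = (LINT z|lborel. F z * cnj (G z))"
  unfolding L2_inner_def
proof (rule integral_chart)
  show "(\<lambda>x. f x * cnj (g x)) \<in> borel_measurable lebesgue"
    using L2_inner_integrable[OF assms(1,2)] by auto
  show "AE z in lborel. f (\<iota> z) * cnj (g (\<iota> z)) = F z * cnj (G z)"
    using assms(5,6) by eventually_elim simp
qed measurable

end

context plane_chart
begin

text \<open>Both the normalised dilate and the lattice shifts have bounded support, so the expansion
  of the former is finite. The dilation stretches the first coordinate only, hence the row index
  stays within \<open>2 * R\<close> for every \<open>N\<close>; unit norm of the dilate bounds the
  coefficients by 1.\<close>

lemma
  assumes box: "box_function \<Phi> R" and phi: "\<phi> \<in> L2_space" and eq: "AE z in lborel. \<phi> (\<iota> z) = \<Phi> z"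
    and onb: "L2_orthonormal_basis {k. \<forall>n. k $ n \<in> \<int>} (\<lambda>k x. \<phi> (x - k)) S"
  shows lattice_orthonormal: "\<And>m n :: int. (LINT z|lborel. \<Phi> z * cnj (\<Phi> (z - (of_int m, of_int n))))
      = (if m = 0 \<and> n = 0 then 1 else 0)"
    and refinable_if_dilates_in_basis_space:
      "(\<And>X. \<exists>N>X. N > 0 \<and> (\<lambda>x. of_real (1 / sqrt N) * \<phi> (\<iota> (fst (\<kappa> x) / N, snd (\<kappa> x)))) \<in> S) \<Longrightarrow>
        refinable_fst \<Phi> \<lceil>2 * R\<rceil>"
proof -
  interpret box_function \<Phi> R by (rule box)
  define pt where "pt = (\<lambda>(m, n). (of_int m, of_int n) :: real \<times> real)"
  let ?e = "\<lambda>k x. \<phi> (x - k)" and ?I = "{k::real^2. \<forall>n. k $ n \<in> \<int>}"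
  have I: "?I = range (\<lambda>k. \<iota> (pt k))"
    unfolding lattice pt_def by (simp add: case_prod_unfold)
  have inj: "inj (\<lambda>k. \<iota> (pt k))"
  proof (rule injI)
    fix k l assume "\<iota> (pt k) = \<iota> (pt l)"
    then have "pt k = pt l" by (metis chart_inv(2))
    then show "k = l" by (auto simp: pt_def split: prod.splits)
  qed
  have S: "S \<subseteq> L2_space" using onb by (auto simp: L2_orthonormal_basis_def L2_closure_def)
  have e: "?e (\<iota> (pt k)) \<in> L2_space" for k
  proof -
    have "\<forall>k\<in>?I. ?e k \<in> S" using onb unfolding L2_orthonormal_basis_def by (elim conjE)
    then show ?thesis using S I by blast
  qed
  have orth: "L2_inner (?e (\<iota> (pt k))) (?e (\<iota> (pt l))) = (if k = l then 1 else 0)" for k l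
  proof -
    have "\<iota> (pt k) \<in> ?I" "\<iota> (pt l) \<in> ?I" unfolding I by auto
    then have "L2_inner (?e (\<iota> (pt k))) (?e (\<iota> (pt l))) = (if \<iota> (pt k) = \<iota> (pt l) then 1 else 0)"
      using onb unfolding L2_orthonormal_basis_def by blast
    moreover have "\<iota> (pt k) = \<iota> (pt l) \<longleftrightarrow> k = l" using injD[OF inj, of k l] by auto
    ultimately show ?thesis by simp
  qed
  have e_eq: "AE z in lborel. \<phi> (\<iota> z - \<iota> (pt k)) = \<Phi> (z - pt k)" for k
    using AE_lborel_shift[OF eq, of "pt k"] by (simp add: chart_diff)
  have pt0: "pt (0, 0) = 0" by (simp add: pt_def zero_prod_def)
  show gram: "(LINT z|lborel. \<Phi> z * cnj (\<Phi> (z - (of_int m, of_int n))))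
      = (if m = 0 \<and> n = 0 then 1 else 0)" for m n :: int
  proof -
    have "L2_inner (?e (\<iota> (pt (0, 0)))) (?e (\<iota> (pt (m, n))))
        = (LINT z|lborel. \<Phi> (z - pt (0, 0)) * cnj (\<Phi> (z - pt (m, n))))"
      by (rule L2_inner_chart[OF e e _ _ e_eq e_eq]) measurable
    from trans[OF this[symmetric] orth]
    have "(LINT z|lborel. \<Phi> z * cnj (\<Phi> (z - pt (m, n)))) = (if (0, 0) = (m, n) then 1 else 0)"
      unfolding pt0 diff_zero .
    then show ?thesis unfolding pt_def case_prod_conv by auto
  qed
  assume dil: "\<And>X. \<exists>N>X. N > 0 \<and> (\<lambda>x. of_real (1 / sqrt N) * \<phi> (\<iota> (fst (\<kappa> x) / N, snd (\<kappa> x)))) \<in> S"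
  show "refinable_fst \<Phi> \<lceil>2 * R\<rceil>"
    unfolding refinable_fst_def
  proof
    fix X :: real
    obtain N where N: "N > X" "N > 0"
      and gS: "(\<lambda>x. of_real (1 / sqrt N) * \<phi> (\<iota> (fst (\<kappa> x) / N, snd (\<kappa> x)))) \<in> S"
      using dil by blast
    define g where "g = (\<lambda>x. of_real (1 / sqrt N) * \<phi> (\<iota> (fst (\<kappa> x) / N, snd (\<kappa> x))))"
    define \<Gamma> where "\<Gamma> = (\<lambda>z. of_real (1 / sqrt N) * \<Phi> (fst z / N, snd z))"
    have gS: "g \<in> S" using gS by (simp add: g_def)
    then have g: "g \<in> L2_space" using S by auto
    have [measurable]: "\<Gamma> \<in> borel_measurable borel" unfolding \<Gamma>_def by measurable
    have g_eq: "AE z in lborel. g (\<iota> z) = \<Gamma> z"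
      using AE_lborel_scale_fst[OF N(2) eq] by (simp add: g_def \<Gamma>_def)
    have norm_g: "L2_norm g = 1"
    proof -
      have "L2_inner g g = (LINT z|lborel. \<Gamma> z * cnj (\<Gamma> z))"
        by (rule L2_inner_chart[OF g g _ _ g_eq g_eq]) measurable
      also have "\<dots> = (LINT z|lborel. of_real (1 / N) * (\<Phi> (fst z / N, snd z) * cnj (\<Phi> (fst z / N, snd z))))"
      proof (intro Bochner_Integration.integral_cong refl)
        fix z
        have "complex_of_real (1 / sqrt N) * complex_of_real (1 / sqrt N) = of_real (1 / N)"
          unfolding of_real_mult[symmetric] using N(2) by simp
        then show "\<Gamma> z * cnj (\<Gamma> z) = of_real (1 / N) * (\<Phi> (fst z / N, snd z) * cnj (\<Phi> (fst z / N, snd z)))"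
          unfolding \<Gamma>_def by (simp add: mult_ac)
      qed
      also have "\<dots> = of_real (1 / N) * (LINT z|lborel. \<Phi> (fst z / N, snd z) * cnj (\<Phi> (fst z / N, snd z)))"
        by (rule integral_mult_right_zero)
      also have "(LINT z|lborel. \<Phi> (fst z / N, snd z) * cnj (\<Phi> (fst z / N, snd z)))
          = of_real N * (LINT z|lborel. \<Phi> z * cnj (\<Phi> z))"
        by (rule lborel_integral_scale_fst[OF N(2), of "\<lambda>z. \<Phi> z * cnj (\<Phi> z)"]) measurable
      also have "(LINT z|lborel. \<Phi> z * cnj (\<Phi> z)) = 1"
        using gram[of 0 0] by (simp add: zero_prod_def[symmetric])
      finally have "L2_inner g g = 1" using N(2) by simp
      then have "(L2_norm g)\<^sup>2 = 1"
        unfolding L2_inner_self by (simp only: of_real_eq_1_iff)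
      then show ?thesis by (simp add: power2_eq_1_iff L2_norm_def)
    qed
    \<comment> \<open>The dilate lives where the first coordinate is at most \<open>N * R\<close>
      and the second at most \<open>R\<close> in modulus, a lattice shift within \<open>R\<close> of
      its lattice point. They can meet only for lattice points in \<open>P\<close>, and only the
      column bound \<open>M\<close> grows with \<open>N\<close>.\<close>
    define M where "M = \<lceil>(N + 1) * R\<rceil>"
    define P where "P = {-M..M} \<times> {-\<lceil>2 * R\<rceil>..\<lceil>2 * R\<rceil>}"
    let ?\<Lambda> = "(\<lambda>k. \<iota> (pt k)) ` P"
    have zero: "L2_inner g (?e i) = 0" if i': "i \<in> ?I - ?\<Lambda>" for i
    proof -
      obtain k where i: "i = \<iota> (pt k)" and k: "k \<notin> P" using i' unfolding I by auto
      have "\<Gamma> z * cnj (\<Phi> (z - pt k)) = 0" for z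
      proof (rule ccontr)
        assume "\<Gamma> z * cnj (\<Phi> (z - pt k)) \<noteq> 0"
        then have "\<Phi> (fst z / N, snd z) \<noteq> 0" "\<Phi> (fst z - of_int (fst k), snd z - of_int (snd k)) \<noteq> 0"
          by (auto simp: \<Gamma>_def pt_def case_prod_unfold minus_prod_def)
        then have "\<bar>fst z / N\<bar> \<le> R" and b: "\<bar>snd z\<bar> \<le> R" "\<bar>fst z - of_int (fst k)\<bar> \<le> R" "\<bar>snd z - of_int (snd k)\<bar> \<le> R"
          by (meson supp not_le)+
        then have "\<bar>fst z\<bar> \<le> N * R" using N(2) by (simp add: field_simps)
        then have "\<bar>of_int (fst k)\<bar> \<le> (N + 1) * R" "\<bar>of_int (snd k)\<bar> \<le> 2 * R"
          using b by (auto simp: distrib_right)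
        then have "\<bar>fst k\<bar> \<le> M" "\<bar>snd k\<bar> \<le> \<lceil>2 * R\<rceil>"
          unfolding M_def by linarith+
        then have "k \<in> P" by (auto simp: P_def mem_Times_iff)
        then show False using k by simp
      qed
      then have "(LINT z|lborel. \<Gamma> z * cnj (\<Phi> (z - pt k))) = 0"
        by (simp only: Bochner_Integration.integral_zero)
      moreover have "L2_inner g (?e i) = (LINT z|lborel. \<Gamma> z * cnj (\<Phi> (z - pt k)))"
        unfolding i by (rule L2_inner_chart[OF g e _ _ g_eq e_eq]) measurable
      ultimately show ?thesis by simp
    qed
    have fin: "finite ?\<Lambda>" "?\<Lambda> \<subseteq> ?I" unfolding I by (auto simp: P_def)
    define a where "a = (\<lambda>k. L2_inner g (?e (\<iota> (pt k))))"
    have "AE x in lebesgue. g x = (\<Sum>i\<in>?\<Lambda>. L2_inner g (?e i) * \<phi> (x - i))"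
      by (rule orthonormal_basis_finite_expansion(1)[OF onb gS fin zero])
    then have "AE x in lebesgue. g x = (\<Sum>k\<in>P. a k * \<phi> (x - \<iota> (pt k)))"
      unfolding a_def by (subst (asm) sum.reindex) (auto intro: inj_on_subset[OF inj] simp: comp_def)
    then have "AE z in lborel. g (\<iota> z) = (\<Sum>k\<in>P. a k * \<phi> (\<iota> z - \<iota> (pt k)))"
      by (rule AE_chart)
    moreover have "AE z in lborel. \<forall>k\<in>P. \<phi> (\<iota> z - \<iota> (pt k)) = \<Phi> (z - pt k)"
      using e_eq by (intro AE_finite_allI) (auto simp: P_def)
    ultimately have ae: "AE z in lborel. \<Phi> (fst z / N, snd z)
        = of_real (sqrt N) * (\<Sum>k\<in>P. a k * \<Phi> (z - (of_int (fst k), of_int (snd k))))"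
      using g_eq
    proof eventually_elim
      case (elim z)
      have "\<Gamma> z = (\<Sum>k\<in>P. a k * \<phi> (\<iota> z - \<iota> (pt k)))" using elim by simp
      also have "\<dots> = (\<Sum>k\<in>P. a k * \<Phi> (z - pt k))"
        using elim(2) by (intro sum.cong) auto
      finally have "of_real (sqrt N) * \<Gamma> z = of_real (sqrt N) * (\<Sum>k\<in>P. a k * \<Phi> (z - pt k))"
        by (rule arg_cong)
      moreover have "of_real (sqrt N) * \<Gamma> z = \<Phi> (fst z / N, snd z)"
        using N(2) by (simp add: \<Gamma>_def)
      ultimately show ?case by (simp add: pt_def case_prod_unfold)
    qed
    have "norm (a k) \<le> 1" if "k \<in> P" for k
      using orthonormal_basis_finite_expansion(2)[OF onb gS fin zero, of "\<iota> (pt k)"] that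
      unfolding a_def norm_g by auto
    then show "\<exists>N>X. N > 0 \<and> (\<exists>F::(int \<times> int) set. \<exists>a.
     finite F \<and> F \<subseteq> UNIV \<times> {-\<lceil>2 * R\<rceil>..\<lceil>2 * R\<rceil>} \<and> (\<forall>k\<in>F. norm (a k) \<le> 1) \<and>
     (AE z in lborel. \<Phi> (fst z / N, snd z) =
       of_real (sqrt N) * (\<Sum>k\<in>F. a k * \<Phi> (z - (of_int (fst k), of_int (snd k))))))"
      using N ae by (intro exI[of _ N] conjI exI[of _ P] exI[of _ a]) (auto simp: P_def)
  qed
qed

end

section \<open>The standard and the flipped chart, and a representative on pairs\<close>

definition plane_point :: "real \<times> real \<Rightarrow> real^2" where
  "plane_point z = vector [fst z, snd z]"

definition plane_coords :: "real^2 \<Rightarrow> real \<times> real" where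
  "plane_coords x = (x $ 1, x $ 2)"

lemma plane_point_nth [simp]: "plane_point z $ 1 = fst z" "plane_point z $ 2 = snd z"
  by (simp_all add: plane_point_def)

lemma vec2_eq_iff: "x = y \<longleftrightarrow> x $ 1 = y $ 1 \<and> x $ 2 = y $ 2" for x y :: "'a^2"
  by (auto simp: vec_eq_iff forall_2)

lemma plane_point_measurable [measurable]: "plane_point \<in> borel \<rightarrow>\<^sub>M borel"
proof (rule borel_measurable_continuous_onI)
  have "linear plane_point" by (rule linearI) (auto simp: vec2_eq_iff)
  then show "continuous_on UNIV plane_point"
    by (simp add: linear_continuous_on linear_conv_bounded_linear)
qed

lemma plane_coords_measurable [measurable]: "plane_coords \<in> borel \<rightarrow>\<^sub>M borel"
  unfolding plane_coords_def
  by (intro borel_measurable_continuous_onI continuous_intros)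

lemma distr_plane_point: "distr lborel borel plane_point = lborel"
proof (rule lborel_eqI[symmetric])
  fix l u :: "real^2" assume le: "\<And>b. b \<in> Basis \<Longrightarrow> l \<bullet> b \<le> u \<bullet> b"
  have B: "(Basis :: (real^2) set) = {axis 1 1, axis 2 1}"
    by (auto simp: Basis_vec_def UNIV_2)
  have ne: "axis 1 (1::real) \<noteq> (axis 2 1 :: real^2)" by (simp add: axis_eq_axis)
  have vim: "plane_point -` box l u = box (l $ 1, l $ 2) (u $ 1, u $ 2)"
    by (auto simp: mem_box_cart forall_2 mem_box Basis_prod_def)
  have "emeasure (distr lborel borel plane_point) (box l u) = emeasure lborel (box (l $ 1, l $ 2) (u $ 1, u $ 2))"
    by (subst emeasure_distr) (auto simp: vim)
  also have "\<dots> = ennreal ((u $ 1 - l $ 1) * (u $ 2 - l $ 2))"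
    using le[of "axis 1 1"] le[of "axis 2 1"]
    by (subst emeasure_lborel_box_eq) (auto simp: B inner_axis Basis_prod_def)
  also have "(u $ 1 - l $ 1) * (u $ 2 - l $ 2) = (\<Prod>b\<in>Basis. (u - l) \<bullet> b)"
    unfolding B using ne by (simp add: inner_axis)
  finally show "emeasure (distr lborel borel plane_point) (box l u) = ennreal (\<Prod>b\<in>Basis. (u - l) \<bullet> b)" .
qed simp

interpretation std: plane_chart plane_point plane_coords
proof
  show "{k. \<forall>n. k $ n \<in> \<int>} = range (\<lambda>(m, n). plane_point (of_int m, of_int n))"
  proof (intro equalityI subsetI)
    fix k :: "real^2" assume "k \<in> {k. \<forall>n. k $ n \<in> \<int>}"
    then obtain m n where "k $ 1 = of_int m" "k $ 2 = of_int n" by (metis (mono_tags) mem_Collect_eq Ints_cases)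
    then have "k = (\<lambda>(m, n). plane_point (of_int m, of_int n)) (m, n)" by (simp add: vec2_eq_iff)
    then show "k \<in> range (\<lambda>(m, n). plane_point (of_int m, of_int n))" by blast
  qed (auto simp: forall_2)
qed (auto simp: vec2_eq_iff plane_coords_def distr_plane_point)

interpretation flipped: plane_chart "plane_point \<circ> prod.swap" "prod.swap \<circ> plane_coords"
proof
  show "distr lborel borel (plane_point \<circ> prod.swap) = lborel"
    using distr_distr[of plane_point borel borel prod.swap lborel] by (simp add: distr_swap_lborel distr_plane_point)
  show "{k. \<forall>n. k $ n \<in> \<int>} = range (\<lambda>(m, n). (plane_point \<circ> prod.swap) (of_int m, of_int n))"
    unfolding std.lattice by (auto simp: image_iff)
  show "plane_point \<circ> prod.swap \<in> borel \<rightarrow>\<^sub>M borel" "prod.swap \<circ> plane_coords \<in> borel \<rightarrow>\<^sub>M borel"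
    by measurable
qed (auto simp: std.chart_diff[symmetric])

text \<open>Two repairs turn \<open>\<phi>\<close> into \<open>\<Phi>\<close>: real and imaginary
  parts are replaced by Borel functions equal to them almost everywhere, and the result is cut off
  by a square containing the essential support, so that it vanishes at every outside point.\<close>

lemma box_representative:
  fixes \<phi> :: "real^2 \<Rightarrow> complex"
  assumes phi: "\<phi> \<in> L2_space" and supp: "compactly_supported \<phi>"
  shows "\<exists>\<Phi> R. box_function \<Phi> R \<and> (AE z in lborel. \<phi> (plane_point z) = \<Phi> z)"
proof -
  have m: "\<phi> \<in> borel_measurable lebesgue" using phi by (simp add: L2_space_def)
  obtain r where [measurable]: "r \<in> borel_measurable lborel" and r: "AE x in lborel. Re (\<phi> x) = r x"
    using completion_ex_borel_measurable_real[of "\<lambda>x. Re (\<phi> x)" lborel] m by auto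
  obtain i where [measurable]: "i \<in> borel_measurable lborel" and i: "AE x in lborel. Im (\<phi> x) = i x"
    using completion_ex_borel_measurable_real[of "\<lambda>x. Im (\<phi> x)" lborel] m by auto
  obtain K where K: "compact K" "AE x in lebesgue. x \<notin> K \<longrightarrow> \<phi> x = 0"
    using supp by (auto simp: compactly_supported_def)
  obtain R where R: "\<And>x. x \<in> K \<Longrightarrow> norm x \<le> R" and "R > 0"
    using compact_imp_bounded[OF K(1)] unfolding bounded_pos by blast
  define B where "B = {z::real \<times> real. \<bar>fst z\<bar> \<le> R \<and> \<bar>snd z\<bar> \<le> R}"
  have [measurable]: "B \<in> sets borel"
  proof -
    have "{z \<in> space borel. \<bar>fst z\<bar> \<le> R \<and> \<bar>snd z\<bar> \<le> R} \<in> sets (borel :: (real \<times> real) measure)"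
      by measurable
    then show ?thesis by (simp add: B_def)
  qed
  define \<Phi> where "\<Phi> = (\<lambda>z. indicator B z * (of_real (r (plane_point z)) + \<i> * of_real (i (plane_point z))) :: complex)"
  have [measurable]: "\<Phi> \<in> borel_measurable borel" unfolding \<Phi>_def by measurable
  have "AE x in lebesgue. \<phi> x = of_real (r x) + \<i> * of_real (i x)"
    unfolding AE_completion_iff using r i by eventually_elim (simp add: complex_eq_iff)
  then have eq: "AE x in lebesgue. \<phi> x = \<Phi> (plane_coords x)"
    using K(2)
  proof eventually_elim
    case (elim x)
    show ?case
    proof (cases "plane_coords x \<in> B")
      case False
      then have "R < \<bar>x $ 1\<bar> \<or> R < \<bar>x $ 2\<bar>" by (auto simp: B_def plane_coords_def)
      then have "R < norm x" using component_le_norm_cart[of x 1] component_le_norm_cart[of x 2] by linarith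
      then have "x \<notin> K" using R[of x] by auto
      then show ?thesis using elim False by (simp add: \<Phi>_def)
    qed (use elim in \<open>simp add: \<Phi>_def\<close>)
  qed
  from std.AE_chart[OF this] have eq: "AE z in lborel. \<phi> (plane_point z) = \<Phi> z" by simp
  have "box_function \<Phi> R"
  proof
    show "0 \<le> R" using \<open>R > 0\<close> by simp
    show "\<Phi> (x, y) = 0" if "R < \<bar>x\<bar> \<or> R < \<bar>y\<bar>" for x y
      using that by (auto simp: \<Phi>_def B_def)
    have "integrable lebesgue (\<lambda>x. (norm (\<phi> x))\<^sup>2) \<longleftrightarrow> integrable lborel (\<lambda>z. (norm (\<Phi> z))\<^sup>2)"
      by (rule std.integrable_chart) (use m eq in auto)
    then show "integrable lborel (\<lambda>z. (norm (\<Phi> z))\<^sup>2)" using phi by (simp add: L2_space_def)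
  qed measurable
  with eq show ?thesis by blast
qed

section \<open>Powers of the dilations and the conclusion\<close>

lemma dilation_funpow:
  "(dilation M ^^ n) f = (\<lambda>x. of_real (sqrt \<bar>det M\<bar> ^ n) * f (((*v) M ^^ n) x))"
proof (induction n)
  case (Suc n)
  show ?case
    by (simp only: funpow.simps o_apply Suc.IH) (simp add: dilation_def funpow_swap1 mult_ac)
qed simp

lemma scale_fst_funpow:
  "((*v) (vector [vector [a, 0], vector [0, 1]] :: real^2^2) ^^ n) x = plane_point (a ^ n * x $ 1, x $ 2)"
proof (induction n)
  case (Suc n)
  then show ?case by (simp add: vec2_eq_iff matrix_vector_mult_def sum_2)
qed (simp add: vec2_eq_iff)

lemma scale_snd_funpow:
  "((*v) (vector [vector [1, 0], vector [0, a]] :: real^2^2) ^^ n) x = plane_point (x $ 1, a ^ n * x $ 2)"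
proof (induction n)
  case (Suc n)
  then show ?case by (simp add: vec2_eq_iff matrix_vector_mult_def sum_2)
qed (simp add: vec2_eq_iff)

theorem theorem6p2:
  fixes \<alpha> \<beta> :: int
    and A B :: "real^2^2"
    and \<phi> :: "real^2 \<Rightarrow> complex"
    and V :: "int \<Rightarrow> int \<Rightarrow> (real^2 \<Rightarrow> complex) set"
  assumes "\<alpha> \<ge> 2" and "\<beta> \<ge> 2"
    and "A = vector [vector [of_int \<alpha>, 0], vector [0, 1]]"
    and "B = vector [vector [1, 0], vector [0, of_int \<beta>]]"
    and "BMRA A B \<phi> V"
    and "compactly_supported \<phi>"
  shows "separable \<phi>"
proof -
  note BMRA = \<open>BMRA A B \<phi> V\<close>[unfolded BMRA_def]
  have phi: "\<phi> \<in> L2_space" using BMRA by (elim conjE)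
  have mono: "V i j \<subseteq> V l m" if "i \<le> l" "j \<le> m" for i j l m
    using BMRA that by (elim conjE) blast
  have dil: "(int_funpow (dilation A) i \<circ> int_funpow (dilation B) j) ` V 0 0 = V i j" for i j
    using BMRA by (elim conjE) blast
  have onb: "L2_orthonormal_basis {k. \<forall>n. k $ n \<in> \<int>} (\<lambda>k x. \<phi> (x - k)) (V 0 0)"
    using BMRA by (elim conjE)
  have phiV: "\<phi> \<in> V 0 0"
  proof -
    have "(0::real^2) \<in> {k. \<forall>n. k $ n \<in> \<int>}" by simp
    with onb have "(\<lambda>x. \<phi> (x - 0)) \<in> V 0 0" unfolding L2_orthonormal_basis_def by blast
    then show ?thesis by simp
  qed
  obtain \<Phi> R where box: "box_function \<Phi> R" and eq: "AE z in lborel. \<phi> (plane_point z) = \<Phi> z"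
    using box_representative[OF phi \<open>compactly_supported \<phi>\<close>] by blast
  interpret box_function \<Phi> R by (rule box)
  have detA: "det A = of_int \<alpha>" and detB: "det B = of_int \<beta>"
    unfolding assms(3,4) by (simp_all add: det_2)
  have ref1: "refinable_fst \<Phi> \<lceil>2 * R\<rceil>"
  proof (rule std.refinable_if_dilates_in_basis_space[OF box phi eq onb])
    fix X :: real
    obtain n where n: "X < of_int \<alpha> ^ n" using real_arch_pow[of "of_int \<alpha>" X] \<open>\<alpha> \<ge> 2\<close> by auto
    define N where "N = (of_int \<alpha> :: real) ^ n"
    have N: "N > 0" using \<open>\<alpha> \<ge> 2\<close> by (simp add: N_def)
    \<comment> \<open>Nestedness puts \<open>\<phi>\<close> into the \<open>n\<close>-th dilate of
      \<open>V 0 0\<close>. Solving \<open>\<phi> = (dilation A ^^ n) g\<close> pointwise shows that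
      \<open>g\<close> is the normalised dilate of \<open>\<phi>\<close>, without handling an
      inverse operator.\<close>
    have "\<phi> \<in> V (int n) 0" using phiV mono[of 0 "int n" 0 0] by auto
    then obtain g where g: "g \<in> V 0 0" and "\<phi> = (dilation A ^^ n) g"
      unfolding dil[of "int n" 0, symmetric] by (auto simp: int_funpow_def)
    then have phi_g: "\<phi> x = of_real (sqrt N) * g (plane_point (N * x $ 1, x $ 2))" for x
      unfolding dilation_funpow detA using \<open>\<alpha> \<ge> 2\<close>
      by (simp add: assms(3) scale_fst_funpow N_def real_sqrt_power)
    have "g = (\<lambda>x. of_real (1 / sqrt N) * \<phi> (plane_point (fst (plane_coords x) / N, snd (plane_coords x))))"
    proof
      fix x
      have "plane_point (x $ 1, x $ 2) = x" by (simp add: vec2_eq_iff)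
      then show "g x = of_real (1 / sqrt N) * \<phi> (plane_point (fst (plane_coords x) / N, snd (plane_coords x)))"
        unfolding phi_g using N by (simp add: plane_coords_def)
    qed
    then show "\<exists>N>X. N > 0 \<and> (\<lambda>x. of_real (1 / sqrt N) * \<phi> (plane_point (fst (plane_coords x) / N, snd (plane_coords x)))) \<in> V 0 0"
      using n N g by (intro exI[of _ N]) (simp add: N_def)
  qed
  have eq': "AE z in lborel. \<phi> ((plane_point \<circ> prod.swap) z) = (\<Phi> \<circ> prod.swap) z"
    using AE_lborel_swap[OF eq] by simp
  \<comment> \<open>In the flipped chart \<open>B\<close> stretches the first coordinate of pairs,
    while space, basis and lattice are unchanged.\<close>
  have ref2: "refinable_fst (\<Phi> \<circ> prod.swap) \<lceil>2 * R\<rceil>"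
  proof (rule flipped.refinable_if_dilates_in_basis_space[OF box_function_swap phi eq' onb])
    fix X :: real
    obtain n where n: "X < of_int \<beta> ^ n" using real_arch_pow[of "of_int \<beta>" X] \<open>\<beta> \<ge> 2\<close> by auto
    define N where "N = (of_int \<beta> :: real) ^ n"
    have N: "N > 0" using \<open>\<beta> \<ge> 2\<close> by (simp add: N_def)
    have "\<phi> \<in> V 0 (int n)" using phiV mono[of 0 0 0 "int n"] by auto
    then obtain g where g: "g \<in> V 0 0" and "\<phi> = (dilation B ^^ n) g"
      unfolding dil[of 0 "int n", symmetric] by (auto simp: int_funpow_def)
    then have phi_g: "\<phi> x = of_real (sqrt N) * g (plane_point (x $ 1, N * x $ 2))" for x
      unfolding dilation_funpow detB using \<open>\<beta> \<ge> 2\<close>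
      by (simp add: assms(4) scale_snd_funpow N_def real_sqrt_power)
    have "g = (\<lambda>x. of_real (1 / sqrt N) * \<phi> ((plane_point \<circ> prod.swap)
        (fst ((prod.swap \<circ> plane_coords) x) / N, snd ((prod.swap \<circ> plane_coords) x))))"
    proof
      fix x
      have "plane_point (x $ 1, x $ 2) = x" by (simp add: vec2_eq_iff)
      then show "g x = of_real (1 / sqrt N) * \<phi> ((plane_point \<circ> prod.swap)
        (fst ((prod.swap \<circ> plane_coords) x) / N, snd ((prod.swap \<circ> plane_coords) x)))"
        unfolding phi_g using N by (simp add: plane_coords_def)
    qed
    then show "\<exists>N>X. N > 0 \<and> (\<lambda>x. of_real (1 / sqrt N) * \<phi> ((plane_point \<circ> prod.swap)
        (fst ((prod.swap \<circ> plane_coords) x) / N, snd ((prod.swap \<circ> plane_coords) x)))) \<in> V 0 0"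
      using n N g by (intro exI[of _ N]) (simp add: N_def)
  qed
  obtain f1 f2 where [measurable]: "f1 \<in> borel_measurable borel" "f2 \<in> borel_measurable borel"
    and int: "integrable lborel (\<lambda>x. (norm (f1 x))\<^sup>2)" "integrable lborel (\<lambda>y. (norm (f2 y))\<^sup>2)"
    and f: "AE z in lborel. \<Phi> z = f1 (fst z) * f2 (snd z)"
    using tensor_product_if_refinable[OF ref1 ref2 std.lattice_orthonormal[OF box phi eq onb]] by blast
  have L2: "w \<in> L2_space"
    if [measurable]: "w \<in> borel_measurable borel" and "integrable lborel (\<lambda>x. (norm (w x))\<^sup>2)"
    for w :: "real \<Rightarrow> complex"
    using that by (simp add: L2_space_def measurable_completion integrable_completion)
  have "AE z in lborel. \<phi> (plane_point z) = f1 (fst z) * f2 (snd z)"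
    using eq f by eventually_elim simp
  from std.AE_chart_inv[OF this] have "AE p in lebesgue. \<phi> p = f1 (p $ 1) * f2 (p $ 2)"
    by (simp add: plane_coords_def[symmetric]) (simp add: plane_coords_def)
  then show ?thesis
    unfolding separable_def using L2 int by (intro exI[of _ f1] exI[of _ f2]) simp
qed

end
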